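(* Let $f\in L^2(\Lambda_A,\mu_A)$ with $\|f\|=1$ and let $\mu_f$ be the measure $\mu_f(B)=\langle f,E(B)f\rangle$. Let $\mu_f^{(k)}$ denote the measure $$\mu_f^{(k)}(B)=\sum_{a\in\mathcal{W}_{k,A}}\|S_a^*f\|^2\,\delta_a(B),$$ where $\delta_a$ is the Dirac measure supported at the rational point $x(a)$ in $\Lambda_A$ whose terminating $N$-adic expansion is of the form $x(a)=\frac{a_1}{N}+\frac{a_2}{N^2}+\cdots+\frac{a_k}{N^k}$, for $a=(a_1,\dots,a_k)\in\mathcal{W}_{k,A}$. The measures $\mu_f^{(k)}$ weakly converge to $\mu_f$ (as $k\to\infty$), when considered as functionals on the space of integrable functions $\psi$ on the real line whose Fourier transform satisfies $$\int|t\,\widehat\psi(t)|\,dt<\infty.$$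
   Context: Let $A=(A_{ij})_{i,j=0,\dots,N-1}$ be a matrix with entries in $\{0,1\}$ and $A_{ii}=1$ for all $i$. $\Lambda_A$ is the set of infinite sequences $x=(x_1x_2x_3\dots)$ with $x_i\in\{0,\dots,N-1\}$ and $A_{x_ix_{i+1}}=1$ for all $i\ge1$, identified with the subset of $[0,1]$ of numbers $\sum_{i\ge1}x_iN^{-i}$ whose $N$-adic expansion is admissible in this sense (rational numbers being identified with infinite periodic sequences rather than with finite $N$-adic expansions). $\delta_A$ is the Hausdorff dimension of $\Lambda_A\subset[0,1]$ and $\mu_A$ is the Hausdorff measure on $\Lambda_A$ in dimension $\delta_A$. $\sigma(x_1x_2x_3\dots)=(x_2x_3\dots)$ is the shift; $R_i=\{x\in\Lambda_A:x_1=i\}$, $D_i=\{x\in\Lambda_A:A_{ix_1}=1\}$, and $\sigma_i:D_i\to R_i$ is $\sigma_i(x)=ix$; $\Phi_{\sigma_i}=d(\mu_A\circ\sigma_i)/d\mu_A$ on $D_i$. The operators $S_i$ on $L^2(\Lambda_A,\mu_A)$ are $(S_if)(x)=\chi_{R_i}(x)\,\Phi_{\sigma_i}(\sigma(x))^{-1/2}f(\sigma(x))$. $\mathcal{W}_{k,A}$ is the set of words $a=(a_1,\dots,a_k)$ with letters in $\{0,\dots,N-1\}$ and $A_{a_ia_{i+1}}=1$ for $1\le i\le k-1$, and $S_a=S_{a_1}\cdots S_{a_k}$. $E$ is the projection valued measure on Borel subsets of $\Lambda_A$ for which $E(\{x\in\Lambda_A:(x_1,\dots,x_k)=a\})=S_aS_a^*$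 for all $a\in\mathcal{W}_{k,A}$; $E(B)$ acts on $L^2(\Lambda_A,\mu_A)$ as multiplication by the characteristic function of $B$. The measures are regarded as compactly supported measures on the real line through $\Lambda_A\subset[0,1]$. *)

theory Defs
  imports "HOL-Probability.Probability"
begin

section \<open>Hausdorff measure and dimension\<close>

text \<open>
  The case \<open>s = 0\<close> is separate because \<open>0 powr 0 = 0\<close> in HOL: the diameter of any nonempty
  set has zeroth power 1 here, so that the zero-dimensional Hausdorff measure counts points.
\<close>

definition diam_pow :: "real \<Rightarrow> 'a::metric_space set \<Rightarrow> ennreal" where
  "diam_pow s U =
     (if U = {} then 0 else if s = 0 then 1 else ennreal (diameter U powr s))"

definition hausdorff_content :: "real \<Rightarrow> real \<Rightarrow> 'a::metric_space set \<Rightarrow> ennreal" where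
  "hausdorff_content s d X =
     (INF U \<in> {U :: nat \<Rightarrow> 'a set. X \<subseteq> (\<Union>n. U n) \<and> (\<forall>n. bounded (U n) \<and> diameter (U n) \<le> d)}.
        \<Sum>n. diam_pow s (U n))"

definition hausdorff_measure :: "real \<Rightarrow> 'a::metric_space set \<Rightarrow> ennreal" where
  "hausdorff_measure s X = (SUP d \<in> {0<..}. hausdorff_content s d X)"

definition hausdorff_dim :: "'a::metric_space set \<Rightarrow> ennreal" where
  "hausdorff_dim X = Inf {ennreal s | s. 0 \<le> s \<and> hausdorff_measure s X = 0}"


section \<open>The Hilbert space of square integrable functions\<close>

text \<open>
  Elements are represented by functions, so equality in the Hilbert space is equality almost
  everywhere, and operators act on representatives.
\<close>

definition L2 :: "'a measure \<Rightarrow> ('a \<Rightarrow> complex) set" where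
  "L2 M = {f \<in> borel_measurable M. integrable M (\<lambda>x. (cmod (f x))\<^sup>2)}"

definition L2_inner :: "'a measure \<Rightarrow> ('a \<Rightarrow> complex) \<Rightarrow> ('a \<Rightarrow> complex) \<Rightarrow> complex" where
  "L2_inner M f g = (\<integral>x. cnj (f x) * g x \<partial>M)"

definition L2_norm :: "'a measure \<Rightarrow> ('a \<Rightarrow> complex) \<Rightarrow> real" where
  "L2_norm M f = sqrt (\<integral>x. (cmod (f x))\<^sup>2 \<partial>M)"

text \<open>The adjoint is determined almost everywhere by the condition below.\<close>

definition L2_adjoint ::
    "'a measure \<Rightarrow> (('a \<Rightarrow> complex) \<Rightarrow> 'a \<Rightarrow> complex) \<Rightarrow> ('a \<Rightarrow> complex) \<Rightarrow> 'a \<Rightarrow> complex" where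
  "L2_adjoint M T g =
     (SOME h. h \<in> L2 M \<and> (\<forall>f\<in>L2 M. L2_inner M (T f) g = L2_inner M f h))"

definition orthogonal_projection ::
    "'a measure \<Rightarrow> (('a \<Rightarrow> complex) \<Rightarrow> 'a \<Rightarrow> complex) \<Rightarrow> bool" where
  "orthogonal_projection M P \<longleftrightarrow>
     (\<forall>f\<in>L2 M. P f \<in> L2 M) \<and>
     (\<forall>f\<in>L2 M. \<forall>g\<in>L2 M. (AE x in M. f x = g x) \<longrightarrow> (AE x in M. P f x = P g x)) \<and>
     (\<forall>f\<in>L2 M. \<forall>g\<in>L2 M. \<forall>c d.
        AE x in M. P (\<lambda>y. c * f y + d * g y) x = c * P f x + d * P g x) \<and>
     (\<forall>f\<in>L2 M. AE x in M. P (P f) x = P f x) \<and>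
     (\<forall>f\<in>L2 M. \<forall>g\<in>L2 M. L2_inner M (P f) g = L2_inner M f (P g))"

text \<open>Countable additivity is in the strong operator topology.\<close>

definition projection_valued_measure ::
    "'a measure \<Rightarrow> ('a set \<Rightarrow> ('a \<Rightarrow> complex) \<Rightarrow> 'a \<Rightarrow> complex) \<Rightarrow> bool" where
  "projection_valued_measure M E \<longleftrightarrow>
     (\<forall>B\<in>sets M. orthogonal_projection M (E B)) \<and>
     (\<forall>f\<in>L2 M. AE x in M. E (space M) f x = f x) \<and>
     (\<forall>B\<in>sets M. \<forall>C\<in>sets M. \<forall>f\<in>L2 M. AE x in M. E (B \<inter> C) f x = E B (E C f) x) \<and>
     (\<forall>B :: nat \<Rightarrow> 'a set. range B \<subseteq> sets M \<longrightarrow> disjoint_family B \<longrightarrow>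
        (\<forall>f\<in>L2 M. (\<lambda>n. L2_norm M (\<lambda>x. E (\<Union>i. B i) f x - (\<Sum>i<n. E (B i) f x)))
           \<longlonglongrightarrow> 0))"

definition spectral_measure ::
    "'a measure \<Rightarrow> ('a set \<Rightarrow> ('a \<Rightarrow> complex) \<Rightarrow> 'a \<Rightarrow> complex) \<Rightarrow> ('a \<Rightarrow> complex) \<Rightarrow> 'a measure" where
  "spectral_measure M E f =
     measure_of (space M) (sets M) (\<lambda>B. ennreal (Re (L2_inner M f (E B f))))"


section \<open>The space \<open>\<Lambda>\<^sub>A\<close> and its Hausdorff measure\<close>

text \<open>
  Sequences are indexed from 0, so \<open>x 0\<close> is the first letter.  Only the entries \<open>A i j\<close> with
  \<open>i, j < N\<close> of the matrix matter.
\<close>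

definition Lambda :: "nat \<Rightarrow> (nat \<Rightarrow> nat \<Rightarrow> nat) \<Rightarrow> (nat \<Rightarrow> nat) set" where
  "Lambda N A = {x. \<forall>i. x i < N \<and> A (x i) (x (Suc i)) = 1}"

definition Nadic :: "nat \<Rightarrow> (nat \<Rightarrow> nat) \<Rightarrow> real" where
  "Nadic N x = (\<Sum>i. real (x i) / real N ^ Suc i)"

definition delta :: "nat \<Rightarrow> (nat \<Rightarrow> nat \<Rightarrow> nat) \<Rightarrow> real" where
  "delta N A = enn2real (hausdorff_dim (Nadic N ` Lambda N A))"

definition eventually_zero_seqs :: "(nat \<Rightarrow> nat) set" where
  "eventually_zero_seqs = {x. finite {i. x i \<noteq> 0}}"

text \<open>
  The measure is \<open>B \<mapsto> hausdorff_measure (delta N A) (Nadic N ` B)\<close>, transported to the space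
  of sequences.  A number can have two admissible expansions, exactly one of which is then
  eventually zero; \<open>Nadic N\<close> is injective on the eventually zero sequences and on the others.
  The image of \<open>B\<close> is split accordingly so that the set function is additive in all cases.  If
  \<open>delta N A > 0\<close>, the eventually zero sequences form a null set and the second summand vanishes.
\<close>

definition mu :: "nat \<Rightarrow> (nat \<Rightarrow> nat \<Rightarrow> nat) \<Rightarrow> (nat \<Rightarrow> nat) measure" where
  "mu N A = measure_of (Lambda N A) (sets (restrict_space borel (Lambda N A)))
     (\<lambda>B. hausdorff_measure (delta N A) (Nadic N ` (B - eventually_zero_seqs)) +
          hausdorff_measure (delta N A) (Nadic N ` (B \<inter> eventually_zero_seqs)))"


section \<open>The operators \<open>S\<^sub>i\<close>\<close>

definition shift :: "(nat \<Rightarrow> nat) \<Rightarrow> nat \<Rightarrow> nat" where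
  "shift x = (\<lambda>i. x (Suc i))"

definition R_set :: "nat \<Rightarrow> (nat \<Rightarrow> nat \<Rightarrow> nat) \<Rightarrow> nat \<Rightarrow> (nat \<Rightarrow> nat) set" where
  "R_set N A i = {x \<in> Lambda N A. x 0 = i}"

definition D_set :: "nat \<Rightarrow> (nat \<Rightarrow> nat \<Rightarrow> nat) \<Rightarrow> nat \<Rightarrow> (nat \<Rightarrow> nat) set" where
  "D_set N A i = {x \<in> Lambda N A. A i (x 0) = 1}"

definition prepend :: "nat \<Rightarrow> (nat \<Rightarrow> nat) \<Rightarrow> nat \<Rightarrow> nat" where
  "prepend i x = case_nat i x"

definition Phi :: "nat \<Rightarrow> (nat \<Rightarrow> nat \<Rightarrow> nat) \<Rightarrow> nat \<Rightarrow> (nat \<Rightarrow> nat) \<Rightarrow> ennreal" where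
  "Phi N A i =
     RN_deriv (restrict_space (mu N A) (D_set N A i))
       (measure_of (D_set N A i) (sets (restrict_space (mu N A) (D_set N A i)))
          (\<lambda>B. emeasure (mu N A) (prepend i ` B)))"

definition S_op ::
    "nat \<Rightarrow> (nat \<Rightarrow> nat \<Rightarrow> nat) \<Rightarrow> nat \<Rightarrow> ((nat \<Rightarrow> nat) \<Rightarrow> complex) \<Rightarrow> (nat \<Rightarrow> nat) \<Rightarrow> complex" where
  "S_op N A i f x =
     indicator (R_set N A i) x *
     complex_of_real (enn2real (Phi N A i (shift x)) powr (- 1 / 2)) * f (shift x)"

definition words :: "nat \<Rightarrow> (nat \<Rightarrow> nat \<Rightarrow> nat) \<Rightarrow> nat \<Rightarrow> nat list set" where
  "words N A k =
     {a. length a = k \<and> (\<forall>i<k. a ! i < N) \<and> (\<forall>i. Suc i < k \<longrightarrow> A (a ! i) (a ! Suc i) = 1)}"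

definition S_word ::
    "nat \<Rightarrow> (nat \<Rightarrow> nat \<Rightarrow> nat) \<Rightarrow> nat list \<Rightarrow> ((nat \<Rightarrow> nat) \<Rightarrow> complex) \<Rightarrow> (nat \<Rightarrow> nat) \<Rightarrow> complex" where
  "S_word N A a = foldr (S_op N A) a"

definition S_word_adj ::
    "nat \<Rightarrow> (nat \<Rightarrow> nat \<Rightarrow> nat) \<Rightarrow> nat list \<Rightarrow> ((nat \<Rightarrow> nat) \<Rightarrow> complex) \<Rightarrow> (nat \<Rightarrow> nat) \<Rightarrow> complex" where
  "S_word_adj N A a = L2_adjoint (mu N A) (S_word N A a)"

definition cylinder :: "nat \<Rightarrow> (nat \<Rightarrow> nat \<Rightarrow> nat) \<Rightarrow> nat list \<Rightarrow> (nat \<Rightarrow> nat) set" where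
  "cylinder N A a = {x \<in> Lambda N A. \<forall>i<length a. x i = a ! i}"


section \<open>Measures on the real line\<close>

definition mu_f ::
    "nat \<Rightarrow> (nat \<Rightarrow> nat \<Rightarrow> nat) \<Rightarrow>
     ((nat \<Rightarrow> nat) set \<Rightarrow> ((nat \<Rightarrow> nat) \<Rightarrow> complex) \<Rightarrow> (nat \<Rightarrow> nat) \<Rightarrow> complex) \<Rightarrow>
     ((nat \<Rightarrow> nat) \<Rightarrow> complex) \<Rightarrow> real measure" where
  "mu_f N A E f = distr (spectral_measure (mu N A) E f) borel (Nadic N)"

definition word_point :: "nat \<Rightarrow> nat list \<Rightarrow> real" where
  "word_point N a = (\<Sum>i<length a. real (a ! i) / real N ^ Suc i)"

definition mu_f_approx ::
    "nat \<Rightarrow> (nat \<Rightarrow> nat \<Rightarrow> nat) \<Rightarrow> ((nat \<Rightarrow> nat) \<Rightarrow> complex) \<Rightarrow> nat \<Rightarrow> real measure" where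
  "mu_f_approx N A f k =
     measure_of UNIV (sets borel)
       (\<lambda>B. \<Sum>a\<in>words N A k. ennreal ((L2_norm (mu N A) (S_word_adj N A a f))\<^sup>2) *
              emeasure (return borel (word_point N a)) B)"

definition fourier :: "(real \<Rightarrow> complex) \<Rightarrow> real \<Rightarrow> complex" where
  "fourier \<psi> t = (LINT x|lborel. exp (- (\<i> * complex_of_real (t * x))) * \<psi> x)"

text \<open>
  Members of this space are integrable functions up to null sets, whereas the measures to be
  tested against may have atoms.  A member has exactly one continuous representative, and that
  representative is what is integrated.
\<close>

definition test_space :: "(real \<Rightarrow> complex) set" where
  "test_space = {\<psi>. integrable lborel \<psi> \<and>
                    integrable lborel (\<lambda>t. complex_of_real t * fourier \<psi> t)}"

definition continuous_representative :: "(real \<Rightarrow> complex) \<Rightarrow> (real \<Rightarrow> complex) \<Rightarrow> bool" where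
  "continuous_representative \<psi> g \<longleftrightarrow> continuous_on UNIV g \<and> (AE x in lborel. g x = \<psi> x)"

end

theory Submission
  imports Defs
begin

text \<open>
  Write \<open>\<nu>\<close> for the measure \<open>B \<mapsto> \<langle>f, E(B) f\<rangle>\<close> on \<open>\<Lambda>\<^sub>A\<close>.  It is a finite measure because the values
  of \<open>E\<close> are orthogonal projections and \<open>E\<close> is strongly countably additive
  (\<open>emeasure_spectral_measure\<close>).  For an admissible word \<open>a\<close> of length \<open>k\<close>, the identity
  \<open>E(cylinder a) = S\<^sub>a S\<^sub>a\<^sup>*\<close> gives \<open>\<nu>(cylinder a) = \<langle>f, S\<^sub>a S\<^sub>a\<^sup>* f\<rangle> = \<parallel>S\<^sub>a\<^sup>* f\<parallel>\<^sup>2\<close>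
  (\<open>emeasure_cylinder\<close>).  As the truncation to \<open>k\<close> digits sends this cylinder to the point \<open>x(a)\<close>,
  the measure \<open>\<mu>\<^sub>f\<^sup>(\<^sup>k\<^sup>)\<close> is the image of \<open>\<nu>\<close> under truncation (\<open>mu_f_approx_eq_distr\<close>), while \<open>\<mu>\<^sub>f\<close>
  is the image of \<open>\<nu>\<close> under the full \<open>N\<close>-adic expansion.  Truncations converge pointwise to the full
  expansion, so the integrals of every bounded continuous function converge by dominated
  convergence.

  The step \<open>\<langle>f, S\<^sub>a S\<^sub>a\<^sup>* f\<rangle> = \<parallel>S\<^sub>a\<^sup>* f\<parallel>\<^sup>2\<close> requires that the adjoint exists.  It is written down
  explicitly for a single letter (\<open>adjointable_S_op\<close>), as an instance of a weighted composition
  operator whose weight is a Radon--Nikodym derivative.  No property of the Hausdorff measure enters: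
  if the derivative does not exist, it is 0 by convention and so is the operator, and the points where
  it is 0 or infinite contribute nothing.

  It remains to see that a test function has a bounded continuous representative.  If
  \<open>\<psi>\<close> and \<open>t \<mapsto> t \<psi>^(t)\<close> are integrable, so is \<open>\<psi>^\<close>, and the representative is the inverse Fourier
  transform of \<open>\<psi>^\<close> (\<open>fourier_inversion\<close>).  The inversion theorem is deduced from Levy's inversion
  formula for probability measures: by linearity it holds for integrable densities, it determines
  the integral of \<open>\<psi>\<close> over every bounded interval, and Fubini's theorem shows that the inverse
  transform has the same integrals.
\<close>

section \<open>Square integrable functions\<close>

lemma L2_measurable: "f \<in> L2 M \<Longrightarrow> f \<in> borel_measurable M"
  by (simp add: L2_def)

lemma L2_integrable_square: "f \<in> L2 M \<Longrightarrow> integrable M (\<lambda>x. (cmod (f x))\<^sup>2)"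
  by (simp add: L2_def)

lemma L2I_nn_integral:
  assumes "f \<in> borel_measurable M" "(\<integral>\<^sup>+x. ennreal ((cmod (f x))\<^sup>2) \<partial>M) < \<infinity>"
  shows "f \<in> L2 M"
  using assms by (auto simp: L2_def intro!: integrableI_bounded)

lemma L2_nn_integral_finite:
  assumes "f \<in> L2 M"
  shows "(\<integral>\<^sup>+x. ennreal ((cmod (f x))\<^sup>2) \<partial>M) < \<infinity>"
  using L2_integrable_square[OF assms] by (simp add: integrable_iff_bounded)

lemma L2_nn_integral_eq:
  assumes "f \<in> L2 M"
  shows "(\<integral>\<^sup>+x. ennreal ((cmod (f x))\<^sup>2) \<partial>M) = ennreal ((L2_norm M f)\<^sup>2)"
  using L2_integrable_square[OF assms]
  by (subst nn_integral_eq_integral) (auto simp: L2_norm_def)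

lemma L2_norm_nonneg: "0 \<le> L2_norm M f"
  by (simp add: L2_norm_def)

lemma measurable_cnj [measurable (raw)]:
  "f \<in> borel_measurable M \<Longrightarrow> (\<lambda>x. cnj (f x)) \<in> borel_measurable M"
  by (rule borel_measurable_continuous_on[OF continuous_on_cnj[OF continuous_on_id]])

lemma L2_inner_integrable:
  assumes "f \<in> L2 M" "g \<in> L2 M"
  shows "integrable M (\<lambda>x. cnj (f x) * g x)"
proof (rule Bochner_Integration.integrable_bound)
  show "integrable M (\<lambda>x. (cmod (f x))\<^sup>2 + (cmod (g x))\<^sup>2)"
    using assms by (auto simp: L2_def)
  have [measurable]: "f \<in> borel_measurable M" "g \<in> borel_measurable M"
    using assms by (auto simp: L2_def)
  show "(\<lambda>x. cnj (f x) * g x) \<in> borel_measurable M"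
    by measurable
  have "a * b \<le> a\<^sup>2 + b\<^sup>2" for a b :: real
  proof -
    have "0 \<le> (a - b)\<^sup>2 + a\<^sup>2 + b\<^sup>2" by simp
    then show ?thesis by (simp add: power2_diff)
  qed
  then show "AE x in M. norm (cnj (f x) * g x) \<le> norm ((cmod (f x))\<^sup>2 + (cmod (g x))\<^sup>2)"
    by (auto simp: norm_mult)
qed

lemma L2_inner_self:
  assumes "f \<in> L2 M"
  shows "L2_inner M f f = of_real ((L2_norm M f)\<^sup>2)"
proof -
  have "L2_inner M f f = (\<integral>x. of_real ((cmod (f x))\<^sup>2) \<partial>M)"
    unfolding L2_inner_def by (intro Bochner_Integration.integral_cong refl)
      (metis complex_norm_square mult.commute)
  also have "\<dots> = of_real (\<integral>x. (cmod (f x))\<^sup>2 \<partial>M)"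
    by (simp only: integral_complex_of_real)
  finally show ?thesis by (simp only: L2_norm_def) simp
qed

lemma L2_inner_cong_AE:
  assumes "AE x in M. g x = h x" "g \<in> L2 M" "h \<in> L2 M" "f \<in> L2 M"
  shows "L2_inner M f g = L2_inner M f h"
proof -
  have [measurable]: "f \<in> borel_measurable M" "g \<in> borel_measurable M" "h \<in> borel_measurable M"
    using assms by (auto simp: L2_def)
  show "L2_inner M f g = L2_inner M f h"
    unfolding L2_inner_def using assms(1) by (auto intro!: integral_cong_AE)
qed

lemma L2_inner_commute: "L2_inner M g f = cnj (L2_inner M f g)"
proof -
  have "cnj (L2_inner M f g) = (\<integral>x. cnj (cnj (f x) * g x) \<partial>M)"
    unfolding L2_inner_def by (simp only: Bochner_Integration.integral_cnj)
  also have "\<dots> = L2_inner M g f"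
    unfolding L2_inner_def by (simp add: mult.commute)
  finally show ?thesis by simp
qed

lemma L2_inner_Cauchy_Schwarz:
  assumes "f \<in> L2 M" "g \<in> L2 M"
  shows "cmod (L2_inner M f g) \<le> L2_norm M f * L2_norm M g"
proof -
  have [measurable]: "f \<in> borel_measurable M" "g \<in> borel_measurable M"
    using assms by (auto simp: L2_def)
  have int: "integrable M (\<lambda>x. cmod (f x) * cmod (g x))"
    using L2_inner_integrable[OF assms, THEN integrable_norm] by (simp add: norm_mult)
  define I where "I = (\<integral>x. cmod (f x) * cmod (g x) \<partial>M)"
  have "I \<ge> 0" by (auto simp: I_def)
  have "ennreal (I\<^sup>2) = (\<integral>\<^sup>+x. ennreal (cmod (f x)) * ennreal (cmod (g x)) \<partial>M)\<^sup>2"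
    using \<open>I \<ge> 0\<close> nn_integral_eq_integral[OF int]
    by (simp add: I_def ennreal_power[symmetric] ennreal_mult[symmetric])
  also have "\<dots> \<le> (\<integral>\<^sup>+x. (ennreal (cmod (f x)))\<^sup>2 \<partial>M) * (\<integral>\<^sup>+x. (ennreal (cmod (g x)))\<^sup>2 \<partial>M)"
    by (intro Cauchy_Schwarz_nn_integral) measurable
  also have "\<dots> = ennreal ((L2_norm M f * L2_norm M g)\<^sup>2)"
    using L2_nn_integral_eq[OF assms(1)] L2_nn_integral_eq[OF assms(2)]
    by (simp add: ennreal_power ennreal_mult power_mult_distrib)
  finally have "I\<^sup>2 \<le> (L2_norm M f * L2_norm M g)\<^sup>2"
    by (simp add: ennreal_le_iff)
  then have "I \<le> L2_norm M f * L2_norm M g"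
    by (rule power2_le_imp_le) (simp add: L2_norm_nonneg)
  moreover have "cmod (L2_inner M f g) \<le> I"
    unfolding L2_inner_def I_def
    using integral_norm_bound[of M "\<lambda>x. cnj (f x) * g x"] by (simp add: norm_mult)
  ultimately show ?thesis by simp
qed

lemma L2_add:
  assumes "f \<in> L2 M" "g \<in> L2 M"
  shows "(\<lambda>x. f x + g x) \<in> L2 M"
proof -
  have [measurable]: "f \<in> borel_measurable M" "g \<in> borel_measurable M"
    using assms by (auto simp: L2_def)
  have bound: "(cmod (u + v))\<^sup>2 \<le> 2 * (cmod u)\<^sup>2 + 2 * (cmod v)\<^sup>2" for u v
  proof -
    have "(cmod (u + v))\<^sup>2 \<le> (cmod u + cmod v)\<^sup>2"
      by (intro power_mono norm_triangle_ineq) auto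
    also have "\<dots> \<le> 2 * (cmod u)\<^sup>2 + 2 * (cmod v)\<^sup>2"
      using sum_squares_bound[of "cmod u" "cmod v"] by (simp add: power2_sum)
    finally show ?thesis .
  qed
  have "integrable M (\<lambda>x. (cmod (f x + g x))\<^sup>2)"
  proof (rule Bochner_Integration.integrable_bound)
    show "integrable M (\<lambda>x. 2 * (cmod (f x))\<^sup>2 + 2 * (cmod (g x))\<^sup>2)"
      using assms by (auto simp: L2_def)
  qed (use bound in auto)
  then show ?thesis by (simp add: L2_def)
qed

lemma L2_uminus: "f \<in> L2 M \<Longrightarrow> (\<lambda>x. - f x) \<in> L2 M"
  by (simp add: L2_def)

lemma L2_diff:
  assumes "f \<in> L2 M" "g \<in> L2 M"
  shows "(\<lambda>x. f x - g x) \<in> L2 M"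
  using L2_add[OF assms(1) L2_uminus[OF assms(2)]] by simp

lemma L2_zero: "(\<lambda>x. 0) \<in> L2 M"
  by (simp add: L2_def)

lemma L2_sum: "(\<And>i. i \<in> I \<Longrightarrow> g i \<in> L2 M) \<Longrightarrow> (\<lambda>x. \<Sum>i\<in>I. g i x) \<in> L2 M"
  by (induction I rule: infinite_finite_induct) (auto simp: L2_zero intro!: L2_add)

lemma L2_inner_diff_right:
  assumes "f \<in> L2 M" "g \<in> L2 M" "h \<in> L2 M"
  shows "L2_inner M f (\<lambda>x. g x - h x) = L2_inner M f g - L2_inner M f h"
  unfolding L2_inner_def using L2_inner_integrable[OF assms(1,2)] L2_inner_integrable[OF assms(1,3)]
  by (simp add: right_diff_distrib)

lemma L2_inner_sum_right:
  assumes "f \<in> L2 M" "\<And>i. i \<in> I \<Longrightarrow> g i \<in> L2 M"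
  shows "L2_inner M f (\<lambda>x. \<Sum>i\<in>I. g i x) = (\<Sum>i\<in>I. L2_inner M f (g i))"
  unfolding L2_inner_def using L2_inner_integrable[OF assms(1) assms(2)]
  by (simp add: sum_distrib_left Bochner_Integration.integral_sum)

lemma L2_inner_tendsto:
  assumes f: "f \<in> L2 M" and g: "g \<in> L2 M" and h: "\<And>n. h n \<in> L2 M"
    and lim: "(\<lambda>n. L2_norm M (\<lambda>x. g x - h n x)) \<longlonglongrightarrow> 0"
  shows "(\<lambda>n. L2_inner M f (h n)) \<longlonglongrightarrow> L2_inner M f g"
proof -
  have "(\<lambda>n. L2_inner M f g - L2_inner M f (h n)) \<longlonglongrightarrow> 0"
  proof (rule Lim_null_comparison)
    show "\<forall>\<^sub>F n in sequentially. norm (L2_inner M f g - L2_inner M f (h n))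
            \<le> L2_norm M f * L2_norm M (\<lambda>x. g x - h n x)"
      using L2_inner_Cauchy_Schwarz[OF f L2_diff[OF g h]] L2_inner_diff_right[OF f g h] by simp
    show "(\<lambda>n. L2_norm M f * L2_norm M (\<lambda>x. g x - h n x)) \<longlonglongrightarrow> 0"
      using tendsto_mult_right_zero[OF lim] by simp
  qed
  from tendsto_diff[OF tendsto_const[of "L2_inner M f g"] this] show ?thesis by simp
qed

section \<open>The measure defined by a projection valued measure and a vector\<close>

lemma orthogonal_projection_inner:
  assumes "orthogonal_projection M P" "f \<in> L2 M"
  shows "L2_inner M f (P f) = of_real ((L2_norm M (P f))\<^sup>2)"
proof -
  note P = assms(1)[unfolded orthogonal_projection_def]
  have Pf: "P f \<in> L2 M"
    using P assms(2) by simp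
  have PPf: "P (P f) \<in> L2 M" and idem: "AE x in M. P (P f) x = P f x"
    and adj: "L2_inner M (P f) (P f) = L2_inner M f (P (P f))"
    using P assms(2) Pf by simp_all
  have "L2_inner M f (P f) = L2_inner M f (P (P f))"
    using L2_inner_cong_AE[OF idem PPf Pf assms(2)] by simp
  then show ?thesis
    using adj L2_inner_self[OF Pf] by simp
qed

context
  fixes M :: "'a measure" and E f
  assumes pvm: "projection_valued_measure M E" and f: "f \<in> L2 M"
begin

lemma pvm_projection: "B \<in> sets M \<Longrightarrow> orthogonal_projection M (E B)"
  using pvm by (simp add: projection_valued_measure_def)

lemma pvm_L2: "B \<in> sets M \<Longrightarrow> E B f \<in> L2 M"
  using pvm_projection f by (simp add: orthogonal_projection_def)

lemma pvm_inner:
  assumes "B \<in> sets M"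
  shows "L2_inner M f (E B f) = of_real ((L2_norm M (E B f))\<^sup>2)"
  using pvm_projection[OF assms] f by (rule orthogonal_projection_inner)

text \<open>
  Strong convergence of the partial sums of projections is only used after pairing with the
  fixed vector \<open>f\<close>, where Cauchy--Schwarz turns it into convergence of numbers.
\<close>

lemma pvm_sums:
  fixes B :: "nat \<Rightarrow> 'a set"
  assumes B: "range B \<subseteq> sets M" "disjoint_family B"
  shows "(\<lambda>i. Re (L2_inner M f (E (B i) f))) sums Re (L2_inner M f (E (\<Union>i. B i) f))"
proof -
  have "(\<Union>i. B i) \<in> sets M" using B by auto
  have "(\<lambda>n. L2_norm M (\<lambda>x. E (\<Union>i. B i) f x - (\<Sum>i<n. E (B i) f x))) \<longlonglongrightarrow> 0"
    using pvm f B by (simp add: projection_valued_measure_def)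
  then have "(\<lambda>n. L2_inner M f (\<lambda>x. \<Sum>i<n. E (B i) f x)) \<longlonglongrightarrow> L2_inner M f (E (\<Union>i. B i) f)"
    using B by (intro L2_inner_tendsto f pvm_L2 L2_sum) auto
  also have "(\<lambda>n. L2_inner M f (\<lambda>x. \<Sum>i<n. E (B i) f x)) = (\<lambda>n. \<Sum>i<n. L2_inner M f (E (B i) f))"
    using B by (intro ext L2_inner_sum_right f pvm_L2) auto
  finally have "(\<lambda>i. L2_inner M f (E (B i) f)) sums L2_inner M f (E (\<Union>i. B i) f)"
    by (simp add: sums_def)
  then show ?thesis by (rule sums_Re)
qed

lemma pvm_empty: "Re (L2_inner M f (E {} f)) = 0"
proof -
  let ?c = "Re (L2_inner M f (E {} f))"
  \<comment> \<open>The empty set is the disjoint union of countably many copies of itself.\<close>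
  have "(\<lambda>i::nat. ?c) sums ?c"
    using pvm_sums[of "\<lambda>_. {}"] by (simp add: disjoint_family_on_def)
  then have "(\<lambda>i::nat. ?c) \<longlonglongrightarrow> 0"
    by (intro summable_LIMSEQ_zero sums_summable)
  then show ?thesis by (simp add: LIMSEQ_const_iff)
qed

lemma space_spectral_measure: "space (spectral_measure M E f) = space M"
  by (simp add: spectral_measure_def sets.space_closed)

lemma sets_spectral_measure: "sets (spectral_measure M E f) = sets M"
  by (simp add: spectral_measure_def sets.space_closed sets.sigma_sets_eq)

lemma emeasure_spectral_measure:
  assumes "B \<in> sets M"
  shows "emeasure (spectral_measure M E f) B = ennreal (Re (L2_inner M f (E B f)))"
  unfolding spectral_measure_def
proof (rule emeasure_measure_of_sigma)
  show "sigma_algebra (space M) (sets M)" by (rule sets.sigma_algebra_axioms)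
  show "positive (sets M) (\<lambda>B. ennreal (Re (L2_inner M f (E B f))))"
    by (simp add: positive_def pvm_empty)
  show "countably_additive (sets M) (\<lambda>B. ennreal (Re (L2_inner M f (E B f))))"
  proof (rule countably_additiveI)
    fix B :: "nat \<Rightarrow> 'a set"
    assume B: "range B \<subseteq> sets M" "disjoint_family B" "(\<Union>i. B i) \<in> sets M"
    have nonneg: "0 \<le> Re (L2_inner M f (E (B i) f))" for i
      using B by (subst pvm_inner) auto
    note s = pvm_sums[OF B(1,2)]
    show "(\<Sum>i. ennreal (Re (L2_inner M f (E (B i) f)))) = ennreal (Re (L2_inner M f (E (\<Union> (range B)) f)))"
      using suminf_ennreal2[OF nonneg sums_summable[OF s]] sums_unique[OF s] by simp
  qed
qed (rule assms)

lemma finite_measure_spectral_measure: "finite_measure (spectral_measure M E f)"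
proof (rule finite_measureI)
  show "emeasure (spectral_measure M E f) (space (spectral_measure M E f)) \<noteq> \<infinity>"
    unfolding space_spectral_measure emeasure_spectral_measure[OF sets.top] by simp
qed

end

section \<open>Adjoints of weighted composition operators\<close>

text \<open>
  An operator on representatives that maps square integrable functions to square integrable
  functions and has an adjoint on all of \<open>L2 M\<close>.  For such operators the choice made in the
  definition of \<open>L2_adjoint\<close> is a genuine adjoint.
\<close>

definition adjointable :: "'a measure \<Rightarrow> (('a \<Rightarrow> complex) \<Rightarrow> 'a \<Rightarrow> complex) \<Rightarrow> bool" where
  "adjointable M T \<longleftrightarrow>
     (\<forall>f\<in>L2 M. T f \<in> L2 M) \<and>
     (\<forall>g\<in>L2 M. \<exists>h\<in>L2 M. \<forall>f\<in>L2 M. L2_inner M (T f) g = L2_inner M f h)"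

lemma adjointable_id: "adjointable M id"
  by (auto simp: adjointable_def)

lemma adjointable_comp:
  assumes S: "adjointable M S" and T: "adjointable M T"
  shows "adjointable M (S \<circ> T)"
  unfolding adjointable_def
proof (intro conjI ballI)
  fix g assume "g \<in> L2 M"
  then obtain h where h: "h \<in> L2 M" "\<forall>f\<in>L2 M. L2_inner M (S f) g = L2_inner M f h"
    using S unfolding adjointable_def by metis
  then obtain h' where h': "h' \<in> L2 M" "\<forall>f\<in>L2 M. L2_inner M (T f) h = L2_inner M f h'"
    using T unfolding adjointable_def by metis
  have "\<forall>f\<in>L2 M. L2_inner M ((S \<circ> T) f) g = L2_inner M f h'"
    using h h' T by (simp add: adjointable_def)
  with h'(1) show "\<exists>h\<in>L2 M. \<forall>f\<in>L2 M. L2_inner M ((S \<circ> T) f) g = L2_inner M f h"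
    by blast
qed (use S T in \<open>simp add: adjointable_def\<close>)

lemma L2_adjoint_adjointable:
  assumes "adjointable M T" "g \<in> L2 M"
  shows "L2_adjoint M T g \<in> L2 M"
    and "f \<in> L2 M \<Longrightarrow> L2_inner M (T f) g = L2_inner M f (L2_adjoint M T g)"
proof -
  have "\<exists>h. h \<in> L2 M \<and> (\<forall>f\<in>L2 M. L2_inner M (T f) g = L2_inner M f h)"
    using assms unfolding adjointable_def by blast
  from someI_ex[OF this, folded L2_adjoint_def]
  show "L2_adjoint M T g \<in> L2 M"
    and "f \<in> L2 M \<Longrightarrow> L2_inner M (T f) g = L2_inner M f (L2_adjoint M T g)"
    by blast+
qed

text \<open>
  The density may take the value \<open>\<infinity>\<close>; there \<open>enn2real\<close> is 0, so the two sides agree for integrands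
  that vanish at those points.
\<close>

lemma integral_density_enn2real:
  fixes H :: "'a \<Rightarrow> complex"
  assumes [measurable]: "\<phi> \<in> borel_measurable M" "H \<in> borel_measurable M"
    and H: "\<And>x. \<phi> x = \<infinity> \<Longrightarrow> H x = 0"
  shows "(\<integral>x. H x \<partial>density M \<phi>) = (\<integral>x. enn2real (\<phi> x) *\<^sub>R H x \<partial>M)"
proof -
  let ?b = "\<lambda>x. of_bool (\<phi> x \<noteq> \<infinity>) :: real"
  have [measurable]: "?b \<in> borel_measurable M" by measurable
  have "(\<integral>x. H x \<partial>density M \<phi>) = (\<integral>x. ?b x *\<^sub>R H x \<partial>density M \<phi>)"
    using H by (intro Bochner_Integration.integral_cong) auto
  also have "\<dots> = (\<integral>x. H x \<partial>density (density M \<phi>) ?b)"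
    by (subst integral_density) auto
  also have "density (density M \<phi>) ?b = density M (\<lambda>x. \<phi> x * ennreal (?b x))"
    by (intro density_density_eq) auto
  also have "\<dots> = density M (\<lambda>x. ennreal (enn2real (\<phi> x)))"
    by (intro density_cong) (auto simp: less_top[symmetric])
  also have "(\<integral>x. H x \<partial>\<dots>) = (\<integral>x. enn2real (\<phi> x) *\<^sub>R H x \<partial>M)"
    by (subst integral_density) auto
  finally show ?thesis .
qed

text \<open>
  An abstract form of the operators \<open>S\<^sub>i\<close>: \<open>s\<close> plays the part of the shift from \<open>R\<close> to \<open>D\<close>
  and \<open>p\<close> that of the branch \<open>\<sigma>\<^sub>i\<close> from \<open>D\<close> to \<open>R\<close>.  No finiteness of the measure and no absolute
  continuity is assumed.
\<close>

locale weighted_composition =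
  fixes M :: "'a measure" and R D :: "'a set" and s p :: "'a \<Rightarrow> 'a"
  assumes R: "R \<in> sets M" and D: "D \<in> sets M"
    and s: "s \<in> measurable (restrict_space M R) (restrict_space M D)"
    and p: "p \<in> measurable (restrict_space M D) (restrict_space M R)"
    and ps: "\<And>x. x \<in> R \<Longrightarrow> p (s x) = x"
begin

abbreviation "MR \<equiv> restrict_space M R"
abbreviation "MD \<equiv> restrict_space M D"

text \<open>
  The Radon--Nikodym derivative with respect to \<open>M\<close> on \<open>D\<close> of the image under \<open>s\<close> of \<open>M\<close>
  restricted to \<open>R\<close>.
\<close>

definition \<phi> :: "'a \<Rightarrow> ennreal" where
  "\<phi> = RN_deriv MD (distr MR MD s)"

text \<open>
  The operator \<open>f \<mapsto> \<chi>\<^sub>R (\<phi> \<circ> s) ^ (-1/2) (f \<circ> s)\<close>.  Where \<open>\<phi>\<close> is 0 or \<open>\<infinity>\<close> the real number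
  \<open>enn2real (\<phi> (s x)) powr (-1/2)\<close> is 0.
\<close>

definition S :: "('a \<Rightarrow> complex) \<Rightarrow> 'a \<Rightarrow> complex" where
  "S f x = indicator R x * complex_of_real (enn2real (\<phi> (s x)) powr (- 1 / 2)) * f (s x)"

text \<open>
  The adjoint of \<open>S\<close>, namely \<open>g \<mapsto> \<chi>\<^sub>D \<phi> ^ (1/2) (g \<circ> p)\<close>, with the factor 0 where \<open>\<phi>\<close> is \<open>\<infinity>\<close>.
\<close>

definition S' :: "('a \<Rightarrow> complex) \<Rightarrow> 'a \<Rightarrow> complex" where
  "S' g y = indicator D y * complex_of_real (enn2real (\<phi> y) powr (1 / 2)) * g (p y)"

declare s [measurable] p [measurable]

lemma RI: "R \<inter> space M \<in> sets M" and DI: "D \<inter> space M \<in> sets M"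
  using R D by auto

lemma space_MR: "space MR = R" and space_MD: "space MD = D"
  using sets.sets_into_space[OF R] sets.sets_into_space[OF D] by (auto simp: space_restrict_space)

lemma phi_measurable [measurable]: "\<phi> \<in> borel_measurable MD"
  by (simp add: \<phi>_def)

text \<open>
  If no density exists, the derivative is 0 by definition, and then \<open>S\<close> and \<open>S'\<close> vanish.  This
  dichotomy replaces the hypotheses of the Radon--Nikodym theorem.
\<close>

lemma phi_density_or_zero: "distr MR MD s = density MD \<phi> \<or> \<phi> = (\<lambda>_. 0)"
proof (cases "\<exists>f. f \<in> borel_measurable MD \<and> density MD f = distr MR MD s")
  case True
  then show ?thesis using RN_derivI unfolding \<phi>_def by metis
next
  case False
  then have "\<phi> = (\<lambda>_. 0)"
    unfolding \<phi>_def RN_deriv_def by (rule if_not_P)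
  then show ?thesis ..
qed

lemma L2_measurable_MR: "f \<in> L2 M \<Longrightarrow> f \<in> borel_measurable MR"
  and L2_measurable_MD: "f \<in> L2 M \<Longrightarrow> f \<in> borel_measurable MD"
  by (auto dest: L2_measurable intro: measurable_restrict_space1)

text \<open>
  Change of variables along \<open>s\<close>.  The second hypothesis covers the case in which no density exists.
\<close>

lemma nn_integral_R:
  assumes "h \<in> borel_measurable MD" "\<phi> = (\<lambda>_. 0) \<Longrightarrow> h = (\<lambda>_. 0)"
  shows "(\<integral>\<^sup>+x. h (s x) \<partial>MR) = (\<integral>\<^sup>+y. \<phi> y * h y \<partial>MD)"
  using phi_density_or_zero
proof
  assume *: "distr MR MD s = density MD \<phi>"
  have "(\<integral>\<^sup>+x. h (s x) \<partial>MR) = (\<integral>\<^sup>+y. h y \<partial>distr MR MD s)"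
    using assms(1) by (intro nn_integral_distr[symmetric]) auto
  then show ?thesis
    using assms(1) by (simp add: * nn_integral_density)
qed (use assms in simp)

lemma S_L2:
  assumes f: "f \<in> L2 M"
  shows "S f \<in> L2 M"
proof (rule L2I_nn_integral)
  note [measurable] = L2_measurable_MD[OF f]
  let ?w = "\<lambda>y. enn2real (\<phi> y) powr (- 1 / 2)"
  have "(\<lambda>x. complex_of_real (?w (s x)) * f (s x)) \<in> borel_measurable MR"
    by measurable
  then have "(\<lambda>x. indicator R x *\<^sub>R (complex_of_real (?w (s x)) * f (s x))) \<in> borel_measurable M"
    by (subst borel_measurable_restrict_space_iff[OF RI, symmetric])
  also have "(\<lambda>x. indicator R x *\<^sub>R (complex_of_real (?w (s x)) * f (s x))) = S f"
    by (auto simp: S_def indicator_def fun_eq_iff)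
  finally show "S f \<in> borel_measurable M" .
  have "(\<integral>\<^sup>+x. ennreal ((cmod (S f x))\<^sup>2) \<partial>M)
      = (\<integral>\<^sup>+x. ennreal ((?w (s x) * cmod (f (s x)))\<^sup>2) \<partial>MR)"
    by (subst nn_integral_restrict_space[OF RI])
       (auto intro!: nn_integral_cong simp: S_def norm_mult split: split_indicator)
  also have "\<dots> = (\<integral>\<^sup>+y. \<phi> y * ennreal ((?w y * cmod (f y))\<^sup>2) \<partial>MD)"
    by (rule nn_integral_R) (auto simp: fun_eq_iff)
  also have "\<dots> \<le> (\<integral>\<^sup>+y. ennreal ((cmod (f y))\<^sup>2) \<partial>MD)"
  proof (rule nn_integral_mono)
    fix y
    \<comment> \<open>The product \<open>\<phi> y * (?w y)\<^sup>2\<close> is 1 where \<open>0 < \<phi> y < \<infinity>\<close> and 0 elsewhere.\<close>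
    show "\<phi> y * ennreal ((?w y * cmod (f y))\<^sup>2) \<le> ennreal ((cmod (f y))\<^sup>2)"
    proof (cases "\<phi> y")
      case (real r)
      have "r * (r powr (- 1 / 2) * cmod (f y))\<^sup>2 \<le> (cmod (f y))\<^sup>2"
      proof (cases "r = 0")
        case False
        then have "(r powr (- 1 / 2))\<^sup>2 = r powr (- 1)"
          using real by (simp add: powr_power)
        then have "r * (r powr (- 1 / 2) * cmod (f y))\<^sup>2 = (r * r powr (- 1)) * (cmod (f y))\<^sup>2"
          by (simp add: power_mult_distrib)
        also have "r * r powr (- 1) = 1"
          using real False by (simp add: powr_minus)
        finally show ?thesis by simp
      qed simp
      then show ?thesis
        using real by (simp add: ennreal_mult[symmetric] ennreal_leI)
    qed simp
  qed
  also have "\<dots> \<le> (\<integral>\<^sup>+y. ennreal ((cmod (f y))\<^sup>2) \<partial>M)"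
    by (subst nn_integral_restrict_space[OF DI]) (auto intro!: nn_integral_mono split: split_indicator)
  also have "\<dots> < \<infinity>"
    by (rule L2_nn_integral_finite[OF f])
  finally show "(\<integral>\<^sup>+x. ennreal ((cmod (S f x))\<^sup>2) \<partial>M) < \<infinity>" .
qed

lemma S'_L2:
  assumes g: "g \<in> L2 M"
  shows "S' g \<in> L2 M"
proof (rule L2I_nn_integral)
  note [measurable] = L2_measurable_MR[OF g]
  let ?v = "\<lambda>y. enn2real (\<phi> y) powr (1 / 2)"
  have "(\<lambda>x. complex_of_real (?v x) * g (p x)) \<in> borel_measurable MD"
    by measurable
  then have "(\<lambda>x. indicator D x *\<^sub>R (complex_of_real (?v x) * g (p x))) \<in> borel_measurable M"
    by (subst borel_measurable_restrict_space_iff[OF DI, symmetric])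
  also have "(\<lambda>x. indicator D x *\<^sub>R (complex_of_real (?v x) * g (p x))) = S' g"
    by (auto simp: S'_def indicator_def fun_eq_iff)
  finally show "S' g \<in> borel_measurable M" .
  have "(\<integral>\<^sup>+x. ennreal ((cmod (S' g x))\<^sup>2) \<partial>M)
      = (\<integral>\<^sup>+y. ennreal ((?v y * cmod (g (p y)))\<^sup>2) \<partial>MD)"
    by (subst nn_integral_restrict_space[OF DI])
       (auto intro!: nn_integral_cong simp: S'_def norm_mult split: split_indicator)
  also have "\<dots> \<le> (\<integral>\<^sup>+x. ennreal ((cmod (g x))\<^sup>2) \<partial>M)"
    using phi_density_or_zero
  proof
    assume *: "distr MR MD s = density MD \<phi>"
    have "(\<integral>\<^sup>+y. ennreal ((?v y * cmod (g (p y)))\<^sup>2) \<partial>MD)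
        \<le> (\<integral>\<^sup>+y. \<phi> y * ennreal ((cmod (g (p y)))\<^sup>2) \<partial>MD)"
    proof (rule nn_integral_mono)
      fix y
      show "ennreal ((?v y * cmod (g (p y)))\<^sup>2) \<le> \<phi> y * ennreal ((cmod (g (p y)))\<^sup>2)"
      proof (cases "\<phi> y")
        case (real r)
        then have "(r powr (1 / 2))\<^sup>2 = r"
          by (simp add: powr_half_sqrt)
        then show ?thesis
          using real by (simp add: power_mult_distrib ennreal_mult)
      qed simp
    qed
    also have "\<dots> = (\<integral>\<^sup>+y. ennreal ((cmod (g (p y)))\<^sup>2) \<partial>distr MR MD s)"
      unfolding * by (subst nn_integral_density) auto
    also have "\<dots> = (\<integral>\<^sup>+x. ennreal ((cmod (g (p (s x))))\<^sup>2) \<partial>MR)"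
      by (subst nn_integral_distr) auto
    also have "\<dots> = (\<integral>\<^sup>+x. ennreal ((cmod (g x))\<^sup>2) \<partial>MR)"
      by (intro nn_integral_cong) (simp add: space_MR ps)
    also have "\<dots> \<le> (\<integral>\<^sup>+x. ennreal ((cmod (g x))\<^sup>2) \<partial>M)"
      by (subst nn_integral_restrict_space[OF RI]) (auto intro!: nn_integral_mono split: split_indicator)
    finally show ?thesis .
  qed simp
  also have "\<dots> < \<infinity>"
    by (rule L2_nn_integral_finite[OF g])
  finally show "(\<integral>\<^sup>+x. ennreal ((cmod (S' g x))\<^sup>2) \<partial>M) < \<infinity>" .
qed

lemma S_S'_adjoint:
  assumes f: "f \<in> L2 M" and g: "g \<in> L2 M"
  shows "L2_inner M (S f) g = L2_inner M f (S' g)"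
proof -
  note [measurable] = L2_measurable_MR[OF g] L2_measurable_MD[OF f]
  let ?w = "\<lambda>y. enn2real (\<phi> y) powr (- 1 / 2)"
  define H where "H y = complex_of_real (?w y) * cnj (f y) * g (p y)" for y
  have [measurable]: "H \<in> borel_measurable MD"
    unfolding H_def by measurable
  have "L2_inner M (S f) g = (\<integral>x. H (s x) \<partial>MR)"
    unfolding L2_inner_def integral_restrict_space[OF RI]
    by (intro Bochner_Integration.integral_cong) (auto simp: S_def H_def ps split: split_indicator)
  also have "\<dots> = (\<integral>y. enn2real (\<phi> y) *\<^sub>R H y \<partial>MD)"
    using phi_density_or_zero
  proof
    assume *: "distr MR MD s = density MD \<phi>"
    have "(\<integral>x. H (s x) \<partial>MR) = (\<integral>y. H y \<partial>distr MR MD s)"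
      by (rule integral_distr[symmetric]) measurable
    also have "\<dots> = (\<integral>y. enn2real (\<phi> y) *\<^sub>R H y \<partial>MD)"
      unfolding * by (rule integral_density_enn2real) (auto simp: H_def)
    finally show ?thesis .
  qed (simp add: H_def)
  also have "\<dots> = L2_inner M f (S' g)"
    unfolding L2_inner_def integral_restrict_space[OF DI]
  proof (intro Bochner_Integration.integral_cong refl)
    fix y
    have "r * r powr (- 1 / 2) = r powr (1 / 2)" if "0 \<le> r" for r :: real
      using powr_mult_base[OF that, of "- 1 / 2"] by simp
    from this[of "enn2real (\<phi> y)"] have "complex_of_real (enn2real (\<phi> y) * ?w y) = of_real (enn2real (\<phi> y) powr (1 / 2))"
      by simp
    then show "indicator D y *\<^sub>R enn2real (\<phi> y) *\<^sub>R H y = cnj (f y) * S' g y"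
      by (simp add: H_def S'_def scaleR_conv_of_real split: split_indicator)
  qed
  finally show ?thesis .
qed

lemma adjointable_S: "adjointable M S"
  unfolding adjointable_def using S_L2 S'_L2 S_S'_adjoint by blast

end

section \<open>The operators attached to words\<close>

lemma space_mu: "space (mu N A) = Lambda N A"
  by (simp add: mu_def space_measure_of_conv)

lemma sets_mu: "sets (mu N A) = sets (restrict_space borel (Lambda N A))"
  using sets.sets_measure_of_eq[of "restrict_space borel (Lambda N A)"]
  by (simp add: mu_def space_restrict_space)

lemma measurable_mu: "F \<in> measurable borel X \<Longrightarrow> F \<in> measurable (mu N A) X"
  by (subst measurable_cong_sets[OF sets_mu refl]) (rule measurable_restrict_space1)

lemma sets_letter: "{x \<in> Lambda N A. P (x i)} \<in> sets (mu N A)"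
proof -
  have "(\<lambda>x::nat \<Rightarrow> nat. x i) \<in> measurable (mu N A) borel"
    by (intro measurable_mu measurable_product_coordinates)
  moreover have "{n. P n} \<in> sets (borel :: nat measure)"
    by (simp add: sets_borel_eq_count_space)
  ultimately have "(\<lambda>x. x i) -` {n. P n} \<inter> space (mu N A) \<in> sets (mu N A)"
    by (rule measurable_sets)
  also have "(\<lambda>x. x i) -` {n. P n} \<inter> space (mu N A) = {x \<in> Lambda N A. P (x i)}"
    by (auto simp: space_mu)
  finally show ?thesis .
qed

lemma shift_measurable: "shift \<in> measurable borel borel"
  unfolding shift_def
  by (rule measurable_coordinatewise_then_product) (rule measurable_product_coordinates)

lemma prepend_measurable: "prepend i \<in> measurable borel borel"
  unfolding prepend_def
proof (rule measurable_coordinatewise_then_product)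
  fix j
  show "(\<lambda>x. case_nat i x j) \<in> borel_measurable borel"
    by (cases j) (auto intro: measurable_product_coordinates)
qed

lemma measurable_mu_restrict:
  assumes F: "F \<in> measurable borel borel" and X: "X \<subseteq> Lambda N A" "Y \<subseteq> Lambda N A"
    and XY: "\<And>x. x \<in> X \<Longrightarrow> F x \<in> Y"
  shows "F \<in> measurable (restrict_space (mu N A) X) (restrict_space (mu N A) Y)"
proof -
  have sets: "sets (restrict_space (mu N A) Z) = sets (restrict_space borel Z)"
    if "Z \<subseteq> Lambda N A" for Z
    using that by (simp add: sets_restrict_space sets_mu image_image Int_absorb2 flip: Int_assoc)
  have "F \<in> measurable (restrict_space borel X) (restrict_space borel Y)"
    using XY by (intro measurable_restrict_space2 measurable_restrict_space1 F)
      (auto simp: space_restrict_space)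
  then show ?thesis
    by (subst measurable_cong_sets[OF sets[OF X(1)] sets[OF X(2)]])
qed

lemma prepend_shift: "prepend (x 0) (shift x) = x"
  by (auto simp: prepend_def shift_def fun_eq_iff split: nat.split)

lemma shift_prepend: "shift (prepend i x) = x"
  by (simp add: prepend_def shift_def)

lemma shift_R_set: "x \<in> R_set N A i \<Longrightarrow> shift x \<in> D_set N A i"
  by (auto simp: R_set_def D_set_def shift_def Lambda_def)

lemma prepend_D_set: "i < N \<Longrightarrow> x \<in> D_set N A i \<Longrightarrow> prepend i x \<in> R_set N A i"
  by (auto simp: R_set_def D_set_def prepend_def Lambda_def split: nat.split)

lemma weighted_composition_shift:
  assumes "i < N"
  shows "weighted_composition (mu N A) (R_set N A i) (D_set N A i) shift (prepend i)"
proof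
  show "R_set N A i \<in> sets (mu N A)" "D_set N A i \<in> sets (mu N A)"
    unfolding R_set_def D_set_def by (rule sets_letter)+
  have sub: "R_set N A i \<subseteq> Lambda N A" "D_set N A i \<subseteq> Lambda N A"
    by (auto simp: R_set_def D_set_def)
  show "shift \<in> measurable (restrict_space (mu N A) (R_set N A i)) (restrict_space (mu N A) (D_set N A i))"
    using sub shift_R_set by (intro measurable_mu_restrict shift_measurable)
  show "prepend i \<in> measurable (restrict_space (mu N A) (D_set N A i)) (restrict_space (mu N A) (R_set N A i))"
    using sub prepend_D_set[OF assms] by (intro measurable_mu_restrict prepend_measurable)
  show "prepend i (shift x) = x" if "x \<in> R_set N A i" for x
    using that prepend_shift[of x] by (simp add: R_set_def)
qed

text \<open>
  The set function \<open>B \<mapsto> \<mu> (prepend i ` B)\<close> on \<open>D\<^sub>i\<close> is the image of the restriction of \<open>\<mu>\<close> to \<open>R\<^sub>i\<close>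
  under the shift, so \<open>S_op N A i\<close> is an instance of the abstract operator above.
\<close>

lemma adjointable_S_op:
  assumes "i < N"
  shows "adjointable (mu N A) (S_op N A i)"
proof -
  interpret weighted_composition "mu N A" "R_set N A i" "D_set N A i" shift "prepend i"
    by (rule weighted_composition_shift[OF assms])
  have img: "prepend i ` B = shift -` B \<inter> R_set N A i" if "B \<subseteq> D_set N A i" for B
  proof
    show "prepend i ` B \<subseteq> shift -` B \<inter> R_set N A i"
      using that prepend_D_set[OF assms] by (auto simp: shift_prepend)
    show "shift -` B \<inter> R_set N A i \<subseteq> prepend i ` B"
    proof
      fix x assume "x \<in> shift -` B \<inter> R_set N A i"
      then show "x \<in> prepend i ` B"
        using ps[of x] by (metis IntD1 IntD2 image_eqI vimageD)
    qed
  qed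
  have "measure_of (D_set N A i) (sets MD) (\<lambda>B. emeasure (mu N A) (prepend i ` B))
      = measure_of (D_set N A i) (sets MD) (emeasure (distr MR MD shift))"
  proof (rule measure_of_eq)
    show "sets MD \<subseteq> Pow (D_set N A i)"
      using sets.space_closed[of MD] by (simp add: space_MD)
    fix B assume "B \<in> sigma_sets (D_set N A i) (sets MD)"
    then have B: "B \<in> sets MD"
      using sets.sigma_sets_eq[of MD] by (simp add: space_MD)
    then have "B \<subseteq> D_set N A i"
      using sets.sets_into_space[of B MD] by (simp add: space_MD)
    then show "emeasure (mu N A) (prepend i ` B) = emeasure (distr MR MD shift) B"
      using B by (simp add: emeasure_distr s img space_MR emeasure_restrict_space[OF RI])
  qed
  also have "\<dots> = distr MR MD shift"
    using measure_of_of_measure[of "distr MR MD shift"] by (simp add: space_MD)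
  finally have "Phi N A i = \<phi>"
    by (simp add: Phi_def \<phi>_def)
  then have "S_op N A i = S"
    by (simp add: S_op_def S_def fun_eq_iff)
  then show ?thesis
    using adjointable_S by simp
qed

lemma adjointable_S_word:
  assumes "set a \<subseteq> {..<N}"
  shows "adjointable (mu N A) (S_word N A a)"
  using assms
proof (induction a)
  case Nil
  then show ?case
    using adjointable_id by (simp add: S_word_def id_def)
next
  case (Cons i a)
  then have "adjointable (mu N A) (S_op N A i \<circ> S_word N A a)"
    by (intro adjointable_comp adjointable_S_op) auto
  then show ?case
    by (simp add: S_word_def comp_def)
qed

lemma words_letters: "a \<in> words N A k \<Longrightarrow> set a \<subseteq> {..<N}"
  by (auto simp: words_def in_set_conv_nth)

lemma finite_words: "finite (words N A k)"
  by (rule finite_subset[OF _ finite_lists_length_eq[of "{..<N}" k]])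
     (use words_letters in \<open>auto simp: words_def\<close>)

lemma inner_S_word_S_word_adj:
  assumes a: "a \<in> words N A k" and f: "f \<in> L2 (mu N A)"
  shows "L2_inner (mu N A) f (S_word N A a (S_word_adj N A a f))
    = of_real ((L2_norm (mu N A) (S_word_adj N A a f))\<^sup>2)"
proof -
  note adj = adjointable_S_word[OF words_letters[OF a], of A]
  define h where "h = S_word_adj N A a f"
  have h: "h \<in> L2 (mu N A)"
    and "L2_inner (mu N A) (S_word N A a h) f = L2_inner (mu N A) h h"
    using L2_adjoint_adjointable[OF adj f] by (auto simp: h_def S_word_adj_def)
  then have "L2_inner (mu N A) (S_word N A a h) f = of_real ((L2_norm (mu N A) h)\<^sup>2)"
    by (simp add: L2_inner_self)
  then show ?thesis
    by (subst L2_inner_commute) (simp add: h_def)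
qed

section \<open>Fourier inversion for integrable functions with integrable transform\<close>

text \<open>
  The transform with the sign convention of characteristic functions; it is the Fourier transform
  at \<open>-t\<close>.
\<close>

definition conj_fourier :: "(real \<Rightarrow> complex) \<Rightarrow> real \<Rightarrow> complex" where
  "conj_fourier \<psi> t = (\<integral>x. iexp (t * x) * \<psi> x \<partial>lborel)"

text \<open>
  For \<open>t \<noteq> 0\<close> this is the integral of \<open>iexp (- (t * x))\<close> for \<open>x\<close> from \<open>a\<close> to \<open>b\<close>; at \<open>t = 0\<close> the
  value is 0 by division by 0.
\<close>

definition levy_kernel :: "real \<Rightarrow> real \<Rightarrow> real \<Rightarrow> complex" where
  "levy_kernel a b t = (iexp (-(t * a)) - iexp (-(t * b))) / (\<i> * t)"

text \<open>
  The integral in Levy's inversion formula, cut off at \<open>\<bar>t\<bar> < T\<close>.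
\<close>

definition levy_integral :: "real \<Rightarrow> real \<Rightarrow> (real \<Rightarrow> complex) \<Rightarrow> nat \<Rightarrow> complex" where
  "levy_integral a b \<psi> T =
     (\<integral>t. indicator {- real T<..<real T} t *\<^sub>R (levy_kernel a b t * conj_fourier \<psi> t) \<partial>lborel)"

lemma conj_fourier_measurable [measurable]:
  assumes [measurable]: "\<psi> \<in> borel_measurable borel"
  shows "conj_fourier \<psi> \<in> borel_measurable borel"
  unfolding conj_fourier_def[abs_def] by measurable

lemma levy_kernel_measurable [measurable]: "levy_kernel a b \<in> borel_measurable borel"
  unfolding levy_kernel_def[abs_def] by measurable

lemma integrable_iexp_mult:
  assumes "integrable lborel \<psi>"
  shows "integrable lborel (\<lambda>x. iexp (t * x) * \<psi> x)"
proof (rule Bochner_Integration.integrable_bound[OF integrable_norm[OF assms]])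
  show "(\<lambda>x. iexp (t * x) * \<psi> x) \<in> borel_measurable lborel"
    using borel_measurable_integrable[OF assms] by measurable
qed (simp add: norm_mult)

lemma norm_conj_fourier_le: "cmod (conj_fourier \<psi> t) \<le> (\<integral>x. cmod (\<psi> x) \<partial>lborel)"
  unfolding conj_fourier_def
  using integral_norm_bound[of lborel "\<lambda>x. iexp (t * x) * \<psi> x"] by (simp add: norm_mult)

lemma norm_levy_kernel_le:
  assumes "a \<le> b"
  shows "cmod (levy_kernel a b t) \<le> b - a"
proof (cases "t = 0")
  case False
  then show ?thesis
    using Levy_Inversion_aux2[of "-b" "-a" t] assms by (simp add: levy_kernel_def)
qed (use assms in \<open>simp add: levy_kernel_def\<close>)

lemma levy_integrable:
  assumes "a \<le> b" and \<psi>: "integrable lborel \<psi>"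
  shows "integrable lborel (\<lambda>t. indicator {- real T<..<real T} t *\<^sub>R (levy_kernel a b t * conj_fourier \<psi> t))"
proof (rule integrableI_bounded_set_indicator[where B="(b - a) * (\<integral>x. cmod (\<psi> x) \<partial>lborel)"])
  have [measurable]: "\<psi> \<in> borel_measurable borel"
    using borel_measurable_integrable[OF \<psi>] by simp
  show "(\<lambda>t. levy_kernel a b t * conj_fourier \<psi> t) \<in> borel_measurable lborel"
    by measurable
  show "AE t in lborel. t \<in> {- real T<..<real T} \<longrightarrow>
     norm (levy_kernel a b t * conj_fourier \<psi> t) \<le> (b - a) * (\<integral>x. cmod (\<psi> x) \<partial>lborel)"
    using assms by (auto simp: norm_mult intro!: mult_mono norm_levy_kernel_le norm_conj_fourier_le)
qed simp_all

lemma conj_fourier_linear: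
  assumes "integrable lborel \<psi>" "integrable lborel \<psi>'"
  shows "conj_fourier (\<lambda>x. \<psi> x + c * \<psi>' x) t = conj_fourier \<psi> t + c * conj_fourier \<psi>' t"
proof -
  have "conj_fourier (\<lambda>x. \<psi> x + c * \<psi>' x) t
      = (\<integral>x. iexp (t * x) * \<psi> x + c * (iexp (t * x) * \<psi>' x) \<partial>lborel)"
    unfolding conj_fourier_def by (intro Bochner_Integration.integral_cong) (auto simp: algebra_simps)
  then show ?thesis
    using assms[THEN integrable_iexp_mult] by (simp add: conj_fourier_def)
qed

text \<open>
  Levy's inversion formula for the interval from \<open>a\<close> to \<open>b\<close>.  The formula for probability
  measures carries over to complex integrable functions because this property is linear in \<open>\<psi>\<close>.
\<close>

definition levy_invertible :: "real \<Rightarrow> real \<Rightarrow> (real \<Rightarrow> complex) \<Rightarrow> bool" where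
  "levy_invertible a b \<psi> \<longleftrightarrow>
     levy_integral a b \<psi> \<longlonglongrightarrow> 2 * complex_of_real pi * (\<integral>x. indicator {a<..b} x *\<^sub>R \<psi> x \<partial>lborel)"

lemma levy_invertible_linear:
  assumes "a \<le> b" and \<psi>: "integrable lborel \<psi>" "integrable lborel \<psi>'"
    and inv: "levy_invertible a b \<psi>" "levy_invertible a b \<psi>'"
  shows "levy_invertible a b (\<lambda>x. \<psi> x + c * \<psi>' x)"
proof -
  have levy: "levy_integral a b (\<lambda>x. \<psi> x + c * \<psi>' x) T = levy_integral a b \<psi> T + c * levy_integral a b \<psi>' T" for T
  proof -
    let ?i = "\<lambda>t. indicator {- real T<..<real T} t :: real"
    have "levy_integral a b (\<lambda>x. \<psi> x + c * \<psi>' x) T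
      = (\<integral>t. ?i t *\<^sub>R (levy_kernel a b t * conj_fourier \<psi> t)
          + c * (?i t *\<^sub>R (levy_kernel a b t * conj_fourier \<psi>' t)) \<partial>lborel)"
      unfolding levy_integral_def conj_fourier_linear[OF \<psi>]
      by (intro Bochner_Integration.integral_cong) (auto simp: algebra_simps)
    also have "\<dots> = levy_integral a b \<psi> T + c * levy_integral a b \<psi>' T"
      unfolding levy_integral_def integral_mult_right_zero[symmetric]
      by (intro Bochner_Integration.integral_add integrable_mult_right levy_integrable assms(1) \<psi>)
    finally show ?thesis .
  qed
  have int: "(\<integral>x. indicator {a<..b} x *\<^sub>R (\<psi> x + c * \<psi>' x) \<partial>lborel)
    = (\<integral>x. indicator {a<..b} x *\<^sub>R \<psi> x \<partial>lborel) + c * (\<integral>x. indicator {a<..b} x *\<^sub>R \<psi>' x \<partial>lborel)"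
  proof -
    have "(\<integral>x. indicator {a<..b} x *\<^sub>R (\<psi> x + c * \<psi>' x) \<partial>lborel)
      = (\<integral>x. indicator {a<..b} x *\<^sub>R \<psi> x + c * (indicator {a<..b} x *\<^sub>R \<psi>' x) \<partial>lborel)"
      by (intro Bochner_Integration.integral_cong) (auto simp: algebra_simps)
    also have "\<dots> = (\<integral>x. indicator {a<..b} x *\<^sub>R \<psi> x \<partial>lborel) + c * (\<integral>x. indicator {a<..b} x *\<^sub>R \<psi>' x \<partial>lborel)"
      unfolding integral_mult_right_zero[symmetric]
      by (intro Bochner_Integration.integral_add integrable_mult_right integrable_mult_indicator \<psi>) auto
    finally show ?thesis .
  qed
  have "2 * complex_of_real pi * X + c * (2 * complex_of_real pi * Y) = 2 * complex_of_real pi * (X + c * Y)"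
    for X Y :: complex
    by (simp add: algebra_simps)
  moreover have "(\<lambda>T. levy_integral a b \<psi> T + c * levy_integral a b \<psi>' T)
    \<longlonglongrightarrow> 2 * complex_of_real pi * (\<integral>x. indicator {a<..b} x *\<^sub>R \<psi> x \<partial>lborel)
      + c * (2 * complex_of_real pi * (\<integral>x. indicator {a<..b} x *\<^sub>R \<psi>' x \<partial>lborel))"
    using inv unfolding levy_invertible_def by (intro tendsto_add tendsto_mult_left)
  ultimately show ?thesis
    unfolding levy_invertible_def int ext[OF levy] by (simp only:)
qed

lemma levy_invertible_nonneg:
  fixes \<phi> :: "real \<Rightarrow> real"
  assumes "a \<le> b" and \<phi>: "integrable lborel \<phi>" and nn: "\<And>x. 0 \<le> \<phi> x"
  shows "levy_invertible a b (\<lambda>x. of_real (\<phi> x))"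
proof -
  have [measurable]: "\<phi> \<in> borel_measurable borel"
    using borel_measurable_integrable[OF \<phi>] by simp
  define c where "c = (\<integral>x. \<phi> x \<partial>lborel)"
  have "c \<ge> 0" using nn by (simp add: c_def)
  show ?thesis
  proof (cases "c = 0")
    case True
    then have ae: "AE x in lborel. \<phi> x = 0"
      using integral_nonneg_eq_0_iff_AE[OF \<phi>] nn by (simp add: c_def)
    have "conj_fourier (\<lambda>x. of_real (\<phi> x)) t = 0" for t
      unfolding conj_fourier_def using ae by (intro integral_eq_zero_AE) auto
    moreover have "(\<integral>x. indicator {a<..b} x *\<^sub>R complex_of_real (\<phi> x) \<partial>lborel) = 0"
      using ae by (intro integral_eq_zero_AE) auto
    ultimately show ?thesis
      by (simp add: levy_invertible_def levy_integral_def[abs_def])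
  next
    case False
    with \<open>c \<ge> 0\<close> have "c > 0" by simp
    \<comment> \<open>Normalising by the total mass gives a probability density without atoms.\<close>
    define M where "M = density lborel (\<lambda>x. ennreal (\<phi> x / c))"
    have emeasure_M: "emeasure M B = ennreal ((\<integral>x. indicator B x *\<^sub>R \<phi> x \<partial>lborel) / c)"
      if [measurable]: "B \<in> sets borel" for B
    proof -
      have "emeasure M B = (\<integral>\<^sup>+x. ennreal (indicator B x *\<^sub>R \<phi> x / c) \<partial>lborel)"
        unfolding M_def by (subst emeasure_density) (auto intro!: nn_integral_cong split: split_indicator)
      also have "\<dots> = ennreal (\<integral>x. indicator B x *\<^sub>R \<phi> x / c \<partial>lborel)"
        using \<phi> nn \<open>c > 0\<close>
        by (intro nn_integral_eq_integral integrable_divide integrable_mult_indicator) auto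
      finally show ?thesis by simp
    qed
    interpret M: prob_space M
    proof
      have "emeasure M UNIV = 1"
        using emeasure_M[of UNIV] \<open>c > 0\<close> by (simp add: c_def)
      then show "emeasure M (space M) = 1" by (simp add: M_def)
    qed
    interpret M: real_distribution M
      by standard (simp_all add: M_def)
    have measure_M: "measure M B = (\<integral>x. indicator B x *\<^sub>R \<phi> x \<partial>lborel) / c"
      if "B \<in> sets borel" for B
      using emeasure_M[OF that] nn \<open>c > 0\<close> by (simp add: measure_def)
    have zero: "measure M {x} = 0" for x
    proof -
      have "AE y in lborel. indicator {x} y *\<^sub>R \<phi> y = 0"
        using AE_lborel_singleton[of x] by eventually_elim auto
      then have "(\<integral>y. indicator {x} y *\<^sub>R \<phi> y \<partial>lborel) = 0"
        by (rule integral_eq_zero_AE)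
      then show ?thesis
        by (simp add: measure_M)
    qed
    have char_M: "char M t = conj_fourier (\<lambda>x. of_real (\<phi> x)) t / c" for t
    proof -
      have "char M t = (\<integral>x. (\<phi> x / c) *\<^sub>R iexp (t * x) \<partial>lborel)"
        unfolding char_def M_def using nn \<open>c > 0\<close> by (subst integral_density) auto
      also have "\<dots> = (\<integral>x. iexp (t * x) * of_real (\<phi> x) / c \<partial>lborel)"
        by (intro Bochner_Integration.integral_cong) (auto simp: scaleR_conv_of_real)
      finally show ?thesis by (simp add: conj_fourier_def)
    qed
    have interval: "(CLBINT t=- real T..real T. (iexp (-(t * a)) - iexp (-(t * b))) / (\<i> * t) * char M t)
        = levy_integral a b (\<lambda>x. of_real (\<phi> x)) T / c" for T
    proof -
      have "(CLBINT t=- real T..real T. (iexp (-(t * a)) - iexp (-(t * b))) / (\<i> * t) * char M t)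
        = (CLBINT t:{- real T<..<real T}. (iexp (-(t * a)) - iexp (-(t * b))) / (\<i> * t) * char M t)"
        by (subst interval_integral_Ioo) auto
      also have "\<dots> = (\<integral>t. indicator {- real T<..<real T} t *\<^sub>R
            (levy_kernel a b t * conj_fourier (\<lambda>x. of_real (\<phi> x)) t) / c \<partial>lborel)"
        unfolding set_lebesgue_integral_def char_M levy_kernel_def
        by (intro Bochner_Integration.integral_cong refl) (simp add: scaleR_conv_of_real)
      also have "\<dots> = levy_integral a b (\<lambda>x. of_real (\<phi> x)) T / c"
        unfolding levy_integral_def by (rule integral_divide_zero)
      finally show ?thesis .
    qed
    have "(\<lambda>T. complex_of_real (1 / (2 * pi)) * (levy_integral a b (\<lambda>x. of_real (\<phi> x)) T / c)) \<longlonglongrightarrow> measure M {a<..b}"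
      using M.Levy_Inversion[OF assms(1) zero zero] by (simp only: of_int_minus of_int_of_nat_eq interval)
    from tendsto_mult[OF tendsto_const[of "complex_of_real (2 * pi * c)"] this]
    have "levy_integral a b (\<lambda>x. of_real (\<phi> x)) \<longlonglongrightarrow> complex_of_real (2 * pi * c * measure M {a<..b})"
      using \<open>c > 0\<close> by simp
    also have "complex_of_real (2 * pi * c * measure M {a<..b})
        = 2 * complex_of_real pi * complex_of_real (\<integral>x. indicator {a<..b} x *\<^sub>R \<phi> x \<partial>lborel)"
      using \<open>c > 0\<close> by (simp add: measure_M)
    also have "complex_of_real (\<integral>x. indicator {a<..b} x *\<^sub>R \<phi> x \<partial>lborel)
        = (\<integral>x. indicator {a<..b} x *\<^sub>R complex_of_real (\<phi> x) \<partial>lborel)"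
      by (subst integral_complex_of_real[symmetric]) (simp add: scaleR_conv_of_real)
    finally show ?thesis
      by (simp add: levy_invertible_def)
  qed
qed

lemma levy_invertible:
  assumes ab: "a \<le> b" and \<psi>: "integrable lborel \<psi>"
  shows "levy_invertible a b \<psi>"
proof -
  have real: "levy_invertible a b (\<lambda>x. of_real (h x))" and real_int: "integrable lborel (\<lambda>x. complex_of_real (h x))"
    if h: "integrable lborel h" for h :: "real \<Rightarrow> real"
  proof -
    have "levy_invertible a b (\<lambda>x. of_real (max 0 (h x)) + (-1) * of_real (max 0 (- h x)))"
      using h by (intro levy_invertible_linear levy_invertible_nonneg ab integrable_of_real
          Bochner_Integration.integrable_max) auto
    also have "(\<lambda>x. complex_of_real (max 0 (h x)) + (-1) * of_real (max 0 (- h x))) = (\<lambda>x. of_real (h x))"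
      by (auto simp: fun_eq_iff max_def)
    finally show "levy_invertible a b (\<lambda>x. of_real (h x))" .
    show "integrable lborel (\<lambda>x. complex_of_real (h x))"
      using h by simp
  qed
  \<comment> \<open>Four nonnegative functions: positive and negative parts of the real and imaginary parts.\<close>
  have "levy_invertible a b (\<lambda>x. of_real (Re (\<psi> x)) + \<i> * of_real (Im (\<psi> x)))"
    using \<psi> by (intro levy_invertible_linear real real_int ab) auto
  then show ?thesis
    by (simp add: complex_eq[symmetric])
qed

text \<open>
  The inverse of \<open>conj_fourier\<close> on integrable functions with integrable transform.
\<close>

definition inverse_fourier :: "(real \<Rightarrow> complex) \<Rightarrow> real \<Rightarrow> complex" where
  "inverse_fourier F x = (\<integral>t. iexp (- (t * x)) * F t \<partial>lborel) / (2 * pi)"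

lemma integrable_inverse_fourier_kernel:
  assumes "integrable lborel F"
  shows "integrable lborel (\<lambda>t. iexp (- (t * x)) * F t)"
  using integrable_iexp_mult[OF assms, of "-x"] by (simp add: mult.commute)

lemma norm_inverse_fourier_le:
  "cmod (inverse_fourier F x) \<le> (\<integral>t. cmod (F t) \<partial>lborel) / (2 * pi)"
  unfolding inverse_fourier_def
  using integral_norm_bound[of lborel "\<lambda>t. iexp (- (t * x)) * F t"]
  by (simp add: norm_mult norm_divide divide_right_mono)

lemma continuous_inverse_fourier:
  assumes F: "integrable lborel F"
  shows "continuous_on UNIV (inverse_fourier F)"
proof -
  have [measurable]: "F \<in> borel_measurable borel"
    using borel_measurable_integrable[OF F] by simp
  have "isCont (\<lambda>x. \<integral>t. iexp (- (t * x)) * F t \<partial>lborel) x" for x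
    unfolding continuous_at_sequentially comp_def
  proof safe
    fix u :: "nat \<Rightarrow> real" assume u: "u \<longlonglongrightarrow> x"
    show "(\<lambda>n. \<integral>t. iexp (- (t * u n)) * F t \<partial>lborel) \<longlonglongrightarrow> (\<integral>t. iexp (- (t * x)) * F t \<partial>lborel)"
    proof (rule integral_dominated_convergence[where w="\<lambda>t. cmod (F t)"])
      show "AE t in lborel. (\<lambda>n. iexp (- (t * u n)) * F t) \<longlonglongrightarrow> iexp (- (t * x)) * F t"
        by (intro AE_I2 tendsto_intros u)
      show "AE t in lborel. norm (iexp (- (t * u n)) * F t) \<le> cmod (F t)" for n
        by (simp add: norm_mult)
    qed (use F in auto)
  qed
  then show ?thesis
    unfolding inverse_fourier_def by (intro continuous_at_imp_continuous_on ballI continuous_intros) auto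
qed

lemma integral_iexp_interval:
  assumes "a \<le> b" "t \<noteq> 0"
  shows "(\<integral>x. indicator {a<..b} x *\<^sub>R iexp (- (t * x)) \<partial>lborel) = levy_kernel a b t"
proof -
  have "(\<integral>x. indicator {a<..b} x *\<^sub>R iexp (- (t * x)) \<partial>lborel) = (CLBINT x=ereal a..ereal b. iexp (- (t * x)))"
    using assms(1) by (simp add: interval_integral_Ioc set_lebesgue_integral_def)
  also have "\<dots> = iexp (- (t * b)) / (- \<i> * t) - iexp (- (t * a)) / (- \<i> * t)"
  proof (rule interval_integral_FTC_finite)
    show "continuous_on {min a b..max a b} (\<lambda>x. iexp (- (t * x)))"
      by (intro continuous_intros)
    show "((\<lambda>x. iexp (- (t * x)) / (- \<i> * t)) has_vector_derivative iexp (- (t * x)))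
        (at x within {min a b..max a b})" for x
    proof -
      have "((\<lambda>z. exp (- (\<i> * (t * z))) / (- \<i> * t)) has_field_derivative iexp (- (t * x))) (at (of_real x))"
        using assms(2) by (auto intro!: derivative_eq_intros simp: field_simps)
      from has_vector_derivative_real_field[OF this] show ?thesis by simp
    qed
  qed
  also have "\<dots> = levy_kernel a b t"
    using assms(2) by (simp add: levy_kernel_def field_simps)
  finally show ?thesis .
qed

text \<open>
  When the transform is integrable the cut-off in the inversion formula can be dropped.
\<close>

lemma levy_integral_limit:
  assumes ab: "a \<le> b" and F: "integrable lborel (conj_fourier \<psi>)"
  shows "levy_integral a b \<psi> \<longlonglongrightarrow> (\<integral>t. levy_kernel a b t * conj_fourier \<psi> t \<partial>lborel)"
  unfolding levy_integral_def
proof (rule integral_dominated_convergence[where w="\<lambda>t. (b - a) * cmod (conj_fourier \<psi> t)"])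
  have [measurable]: "conj_fourier \<psi> \<in> borel_measurable borel"
    using borel_measurable_integrable[OF F] by simp
  show "(\<lambda>t. levy_kernel a b t * conj_fourier \<psi> t) \<in> borel_measurable lborel"
    "(\<lambda>t. indicator {- real n<..<real n} t *\<^sub>R (levy_kernel a b t * conj_fourier \<psi> t)) \<in> borel_measurable lborel" for n
    by measurable
  show "integrable lborel (\<lambda>t. (b - a) * cmod (conj_fourier \<psi> t))"
    using F by simp
  show "AE t in lborel. (\<lambda>n. indicator {- real n<..<real n} t *\<^sub>R (levy_kernel a b t * conj_fourier \<psi> t))
      \<longlonglongrightarrow> levy_kernel a b t * conj_fourier \<psi> t"
  proof (rule AE_I2, rule tendsto_eventually)
    fix t :: real
    obtain m :: nat where "\<bar>t\<bar> < m" using reals_Archimedean2 by blast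
    then show "\<forall>\<^sub>F n in sequentially. indicator {- real n<..<real n} t *\<^sub>R (levy_kernel a b t * conj_fourier \<psi> t)
        = levy_kernel a b t * conj_fourier \<psi> t"
      by (intro eventually_sequentiallyI[of m]) (auto simp: indicator_def)
  qed
  show "AE t in lborel. norm (indicator {- real n<..<real n} t *\<^sub>R (levy_kernel a b t * conj_fourier \<psi> t))
      \<le> (b - a) * cmod (conj_fourier \<psi> t)" for n
    using ab norm_levy_kernel_le[OF ab]
    by (auto simp: norm_mult indicator_def intro!: mult_right_mono)
qed

lemma integral_inverse_fourier_interval:
  assumes ab: "a \<le> b" and F: "integrable lborel F"
  shows "2 * complex_of_real pi * (\<integral>x. indicator {a<..b} x *\<^sub>R inverse_fourier F x \<partial>lborel)
    = (\<integral>t. levy_kernel a b t * F t \<partial>lborel)"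
proof -
  have [measurable]: "F \<in> borel_measurable borel"
    using borel_measurable_integrable[OF F] by simp
  let ?h = "\<lambda>x t. indicator {a<..b} x *\<^sub>R (iexp (- (t * x)) * F t)"
  have int: "integrable (lborel \<Otimes>\<^sub>M lborel) (\<lambda>(x, t). ?h x t)"
  proof (rule lborel_pair.Fubini_integrable)
    show "(\<lambda>(x, t). ?h x t) \<in> borel_measurable (lborel \<Otimes>\<^sub>M lborel)"
      by measurable
    show "AE x in lborel. integrable lborel (\<lambda>t. case (x, t) of (x, t) \<Rightarrow> ?h x t)"
      using integrable_inverse_fourier_kernel[OF F] by auto
    have "(\<lambda>x. \<integral>t. norm (case (x, t) of (x, t) \<Rightarrow> ?h x t) \<partial>lborel)
        = (\<lambda>x. indicator {a<..b} x *\<^sub>R (\<integral>t. cmod (F t) \<partial>lborel))"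
      by (auto simp: fun_eq_iff norm_mult indicator_def)
    then show "integrable lborel (\<lambda>x. \<integral>t. norm (case (x, t) of (x, t) \<Rightarrow> ?h x t) \<partial>lborel)"
      using ab by (auto intro!: integrable_scaleR_left)
  qed
  have "2 * complex_of_real pi * (\<integral>x. indicator {a<..b} x *\<^sub>R inverse_fourier F x \<partial>lborel)
      = (\<integral>x. (\<integral>t. ?h x t \<partial>lborel) \<partial>lborel)"
  proof -
    have "(\<integral>t. ?h x t \<partial>lborel) = 2 * complex_of_real pi * (indicator {a<..b} x *\<^sub>R inverse_fourier F x)" for x
      by (simp only: integral_scaleR_right) (simp add: inverse_fourier_def)
    then show ?thesis
      by (simp only: integral_mult_right_zero)
  qed
  also have "\<dots> = (\<integral>t. (\<integral>x. ?h x t \<partial>lborel) \<partial>lborel)"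
    by (rule lborel_pair.Fubini_integral[OF int, symmetric])
  also have "\<dots> = (\<integral>t. levy_kernel a b t * F t \<partial>lborel)"
  proof (rule integral_cong_AE)
    show "AE t in lborel. (\<integral>x. ?h x t \<partial>lborel) = levy_kernel a b t * F t"
      using AE_lborel_singleton[of 0]
    proof eventually_elim
      case (elim t)
      have "(\<integral>x. ?h x t \<partial>lborel) = (\<integral>x. (indicator {a<..b} x *\<^sub>R iexp (- (t * x))) * F t \<partial>lborel)"
        by simp
      also have "\<dots> = (\<integral>x. indicator {a<..b} x *\<^sub>R iexp (- (t * x)) \<partial>lborel) * F t"
        by (rule integral_mult_left_zero)
      finally show ?case
        using integral_iexp_interval[OF ab elim] by simp
    qed
  qed measurable
  finally show ?thesis .
qed

text \<open>
  For each truncation of \<open>h\<close> to a bounded interval, the sets over which it has integral 0 form a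
  Dynkin system that contains the half-open intervals, hence all Borel sets.
\<close>

lemma AE_eq_of_interval_integrals:
  fixes h :: "real \<Rightarrow> complex"
  assumes h: "\<And>a b. a \<le> b \<Longrightarrow> integrable lborel (\<lambda>x. indicator {a<..b} x *\<^sub>R h x)"
    and zero: "\<And>a b. a \<le> b \<Longrightarrow> (\<integral>x. indicator {a<..b} x *\<^sub>R h x \<partial>lborel) = 0"
  shows "AE x in lborel. h x = 0"
proof -
  have "AE x in lborel. indicator {- real n<..real n} x *\<^sub>R h x = 0" for n :: nat
  proof (rule sigma_finite_measure.density_zero[OF sigma_finite_lborel])
    let ?h = "\<lambda>x. indicator {- real n<..real n} x *\<^sub>R h x"
    show int: "integrable lborel ?h" by (intro h) simp
    have int_B: "set_integrable lborel B ?h" if "B \<in> sets borel" for B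
      unfolding set_integrable_def using that by (intro integrable_mult_indicator[OF _ int]) simp
    fix B :: "real set" assume "B \<in> sets lborel"
    then have B: "B \<in> sigma_sets UNIV (range (\<lambda>(a, b). {a<..b::real}))"
      by (simp add: borel_sigma_sets_Ioc)
    have "Int_stable (range (\<lambda>(a, b). {a<..b::real}))"
      unfolding Int_stable_def
    proof safe
      fix a b c d :: real
      have "{a<..b} \<inter> {c<..d} = (\<lambda>(a, b). {a<..b}) (max a c, min b d)" by auto
      then show "{a<..b} \<inter> {c<..d} \<in> range (\<lambda>(a, b). {a<..b::real})" by blast
    qed
    moreover have "range (\<lambda>(a, b). {a<..b::real}) \<subseteq> Pow UNIV" by simp
    moreover note B
    ultimately show "set_lebesgue_integral lborel B ?h = 0"
    proof (induction rule: sigma_sets_induct_disjoint)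
      case (basic I)
      then obtain a b where I: "I = {a<..b}" by auto
      have *: "set_lebesgue_integral lborel I ?h
          = (\<integral>x. indicator ({max a (- real n)<..min b (real n)}) x *\<^sub>R h x \<partial>lborel)"
        unfolding set_lebesgue_integral_def I
        by (intro Bochner_Integration.integral_cong) (auto simp: indicator_def)
      show ?case
      proof (cases "max a (- real n) \<le> min b (real n)")
        case True
        then show ?thesis unfolding * by (rule zero)
      next
        case False
        then have empty: "{max a (- real n)<..min b (real n)} = {}"
          by (intro greaterThanAtMost_empty) linarith
        show ?thesis unfolding * empty by simp
      qed
    next
      case empty
      show ?case by (simp add: set_lebesgue_integral_def)
    next
      case (compl B)
      then have B: "B \<in> sets borel" by (simp add: borel_sigma_sets_Ioc)
      have "0 = (\<integral>x. ?h x \<partial>lborel)" by (simp add: zero)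
      also have "\<dots> = set_lebesgue_integral lborel ((UNIV - B) \<union> B) ?h"
        by (simp add: set_lebesgue_integral_def)
      also have "\<dots> = set_lebesgue_integral lborel (UNIV - B) ?h + set_lebesgue_integral lborel B ?h"
        using B by (intro set_integral_Un int_B) auto
      finally show ?case using compl by simp
    next
      case (union B)
      then have B: "B i \<in> sets borel" for i
        using rangeI[of B i] by (simp add: borel_sigma_sets_Ioc subset_iff)
      have "set_lebesgue_integral lborel (\<Union>i. B i) ?h = (\<Sum>i. set_lebesgue_integral lborel (B i) ?h)"
        using B union by (intro lebesgue_integral_countable_add int_B) (auto simp: disjoint_family_on_def)
      then show ?case using union by simp
    qed
  qed
  then have "AE x in lborel. \<forall>n::nat. indicator {- real n<..real n} x *\<^sub>R h x = 0"
    by (subst AE_all_countable) blast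
  then show ?thesis
  proof eventually_elim
    case (elim x)
    obtain n :: nat where "\<bar>x\<bar> < n" using reals_Archimedean2 by blast
    then show ?case using elim[rule_format, of n] by (auto simp: indicator_def)
  qed
qed

text \<open>
  Both sides have the same integral over every bounded interval: the integral of \<open>\<psi>\<close> is given by
  Levy's formula, and that of the inverse transform is computed with Fubini's theorem.
\<close>

lemma fourier_inversion:
  assumes \<psi>: "integrable lborel \<psi>" and F: "integrable lborel (conj_fourier \<psi>)"
  shows "AE x in lborel. inverse_fourier (conj_fourier \<psi>) x = \<psi> x"
proof -
  let ?g = "inverse_fourier (conj_fourier \<psi>)"
  have [measurable]: "?g \<in> borel_measurable borel"
    by (intro borel_measurable_continuous_onI continuous_inverse_fourier F)
  have int: "integrable lborel (\<lambda>x. indicator {a<..b} x *\<^sub>R \<psi> x)"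
    "integrable lborel (\<lambda>x. indicator {a<..b} x *\<^sub>R ?g x)" if "a \<le> b" for a b :: real
  proof -
    show "integrable lborel (\<lambda>x. indicator {a<..b} x *\<^sub>R \<psi> x)"
      using \<psi> by (intro integrable_mult_indicator) auto
    show "integrable lborel (\<lambda>x. indicator {a<..b} x *\<^sub>R ?g x)"
      using that norm_inverse_fourier_le
      by (intro integrableI_bounded_set_indicator[where B="(\<integral>t. cmod (conj_fourier \<psi> t) \<partial>lborel) / (2 * pi)"]) auto
  qed
  have "AE x in lborel. ?g x - \<psi> x = 0"
  proof (rule AE_eq_of_interval_integrals)
    fix a b :: real assume ab: "a \<le> b"
    show "integrable lborel (\<lambda>x. indicator {a<..b} x *\<^sub>R (?g x - \<psi> x))"
      using int[OF ab] by (simp add: scaleR_diff_right)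
    have "levy_integral a b \<psi> \<longlonglongrightarrow> 2 * complex_of_real pi * (\<integral>x. indicator {a<..b} x *\<^sub>R \<psi> x \<partial>lborel)"
      using levy_invertible[OF ab \<psi>] by (simp add: levy_invertible_def)
    moreover have "levy_integral a b \<psi> \<longlonglongrightarrow> 2 * complex_of_real pi * (\<integral>x. indicator {a<..b} x *\<^sub>R ?g x \<partial>lborel)"
      unfolding integral_inverse_fourier_interval[OF ab F] by (rule levy_integral_limit[OF ab F])
    ultimately have "2 * complex_of_real pi * (\<integral>x. indicator {a<..b} x *\<^sub>R \<psi> x \<partial>lborel)
        = 2 * complex_of_real pi * (\<integral>x. indicator {a<..b} x *\<^sub>R ?g x \<partial>lborel)"
      by (rule LIMSEQ_unique)
    then show "(\<integral>x. indicator {a<..b} x *\<^sub>R (?g x - \<psi> x) \<partial>lborel) = 0"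
      using int[OF ab] by (simp add: scaleR_diff_right)
  qed
  then show ?thesis by simp
qed

text \<open>
  The transform of a test function is integrable: it is bounded by the norm of \<open>\<psi>\<close> on \<open>[-1, 1]\<close>,
  and outside by \<open>\<bar>t\<bar>\<close> times its own modulus.  Hence the inverse transform of the transform is a
  bounded continuous representative.
\<close>

lemma test_space_bounded_continuous_representative:
  assumes "\<psi> \<in> test_space"
  obtains g B where "continuous_representative \<psi> g" "\<And>x. cmod (g x) \<le> B"
proof -
  have \<psi>: "integrable lborel \<psi>" and t\<psi>: "integrable lborel (\<lambda>t. complex_of_real t * fourier \<psi> t)"
    using assms by (auto simp: test_space_def)
  have [measurable]: "\<psi> \<in> borel_measurable borel"
    using borel_measurable_integrable[OF \<psi>] by simp
  have fourier: "fourier \<psi> t = conj_fourier \<psi> (- t)" for t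
    by (simp add: fourier_def conj_fourier_def)
  have "integrable lborel (\<lambda>t. complex_of_real (- t) * fourier \<psi> (- t))"
    using lborel_integrable_real_affine[OF t\<psi>, of "-1" 0] by simp
  then have int: "integrable lborel (\<lambda>t. complex_of_real t * conj_fourier \<psi> t)"
    using integrable_minus by (simp add: fourier)
  define C where "C = (\<integral>x. cmod (\<psi> x) \<partial>lborel)"
  have "C \<ge> 0" by (simp add: C_def)
  have "integrable lborel (conj_fourier \<psi>)"
  proof (rule Bochner_Integration.integrable_bound)
    show "integrable lborel (\<lambda>t. indicator {-1..1} t *\<^sub>R C + cmod (of_real t * conj_fourier \<psi> t))"
      using int by (intro Bochner_Integration.integrable_add integrable_norm integrable_scaleR_left) auto
    show "AE t in lborel. norm (conj_fourier \<psi> t)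
        \<le> norm (indicator {-1..1} t *\<^sub>R C + cmod (of_real t * conj_fourier \<psi> t))"
    proof (rule AE_I2)
      fix t :: real
      have "cmod (conj_fourier \<psi> t) \<le> indicator {-1..1} t *\<^sub>R C + \<bar>t\<bar> * cmod (conj_fourier \<psi> t)"
      proof (cases "\<bar>t\<bar> \<le> 1")
        case True
        then have "t \<in> {-1..1}" by auto
        then show ?thesis
          using norm_conj_fourier_le[of \<psi> t] by (simp add: C_def add_increasing2)
      next
        case False
        then have "1 * cmod (conj_fourier \<psi> t) \<le> \<bar>t\<bar> * cmod (conj_fourier \<psi> t)"
          by (intro mult_right_mono) auto
        then show ?thesis using \<open>C \<ge> 0\<close> by (simp add: indicator_def)
      qed
      then show "norm (conj_fourier \<psi> t)
          \<le> norm (indicator {-1..1} t *\<^sub>R C + cmod (of_real t * conj_fourier \<psi> t))"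
        using \<open>C \<ge> 0\<close> by (simp add: norm_mult)
    qed
  qed simp
  then show thesis
    using continuous_inverse_fourier fourier_inversion[OF \<psi>] norm_inverse_fourier_le
    by (intro that[of "inverse_fourier (conj_fourier \<psi>)"]) (auto simp: continuous_representative_def)
qed

section \<open>Discretisations of the spectral measure\<close>

text \<open>
  The number given by the first \<open>k\<close> digits.  On the cylinder of a word \<open>a\<close> of length \<open>k\<close> it is
  constant with value \<open>word_point N a\<close>.
\<close>

definition Nadic_trunc :: "nat \<Rightarrow> nat \<Rightarrow> (nat \<Rightarrow> nat) \<Rightarrow> real" where
  "Nadic_trunc N k x = (\<Sum>i<k. real (x i) / real N ^ Suc i)"

lemma measurable_digit: "(\<lambda>x. real (x i)) \<in> borel_measurable (mu N A)"
proof (rule measurable_compose[of "\<lambda>x. x i" _ borel real])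
  show "(\<lambda>x. x i) \<in> measurable (mu N A) (borel :: nat measure)"
    by (intro measurable_mu measurable_product_coordinates)
  show "real \<in> borel_measurable borel"
    by (intro borel_measurable_continuous_onI continuous_on_of_nat continuous_on_id)
qed

lemma Nadic_trunc_measurable: "Nadic_trunc N k \<in> borel_measurable (mu N A)"
  unfolding Nadic_trunc_def[abs_def]
  by (intro borel_measurable_sum borel_measurable_divide measurable_digit) simp

lemma Nadic_summable:
  assumes "x \<in> Lambda N A"
  shows "summable (\<lambda>i. real (x i) / real N ^ Suc i)"
proof -
  have lt: "x i < N" for i using assms by (simp add: Lambda_def)
  show ?thesis
  \<comment> \<open>The comparison with a geometric series needs \<open>1 < N\<close>; for \<open>N = 1\<close> all digits are 0.\<close>
  proof (cases "N = 1")
    case True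
    then have "x i = 0" for i using lt[of i] by simp
    then show ?thesis by simp
  next
    case False
    then have "1 < N" using lt[of 0] by simp
    show ?thesis
    proof (rule summable_comparison_test')
      show "summable (\<lambda>i. (1 / real N) ^ i)"
        using \<open>1 < N\<close> by (intro summable_geometric) simp
      fix i
      have "real (x i) / real N \<le> 1"
        using lt[of i] by (simp add: divide_le_eq)
      then have "real (x i) / real N * (1 / real N) ^ i \<le> 1 * (1 / real N) ^ i"
        by (intro mult_right_mono) auto
      then show "norm (real (x i) / real N ^ Suc i) \<le> (1 / real N) ^ i"
        by (simp add: power_inverse divide_inverse mult_ac)
    qed
  qed
qed

lemma Nadic_trunc_tendsto:
  assumes "x \<in> Lambda N A"
  shows "(\<lambda>k. Nadic_trunc N k x) \<longlonglongrightarrow> Nadic N x"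
  unfolding Nadic_trunc_def Nadic_def by (rule summable_LIMSEQ[OF Nadic_summable[OF assms]])

lemma Nadic_measurable: "Nadic N \<in> borel_measurable (mu N A)"
  by (rule borel_measurable_LIMSEQ_metric[where f="\<lambda>k. Nadic_trunc N k"])
     (simp_all add: space_mu Nadic_trunc_measurable Nadic_trunc_tendsto)

lemma cylinder_sets: "cylinder N A a \<in> sets (mu N A)"
proof -
  have "cylinder N A a = space (mu N A) \<inter> (\<Inter>i\<in>{..<length a}. {x \<in> Lambda N A. x i = a ! i})
      \<union> (if a = [] then space (mu N A) else {})"
    by (auto simp: cylinder_def space_mu)
  also have "\<dots> \<in> sets (mu N A)"
  proof (cases "a = []")
    case False
    then have "(\<Inter>i\<in>{..<length a}. {x \<in> Lambda N A. x i = a ! i}) \<in> sets (mu N A)"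
      by (intro sets.finite_INT sets_letter) auto
    then show ?thesis using False by auto
  qed auto
  finally show ?thesis .
qed

lemma prefix_in_words:
  assumes "x \<in> Lambda N A"
  shows "map x [0..<k] \<in> words N A k" "x \<in> cylinder N A (map x [0..<k])"
  using assms by (auto simp: words_def Lambda_def cylinder_def)

lemma cylinder_prefix: "x \<in> cylinder N A a \<Longrightarrow> map x [0..<length a] = a"
  by (auto simp: cylinder_def intro: nth_equalityI)

lemma Nadic_trunc_cylinder: "x \<in> cylinder N A a \<Longrightarrow> Nadic_trunc N (length a) x = word_point N a"
  by (simp add: Nadic_trunc_def word_point_def cylinder_def)

context
  fixes N :: nat and A :: "nat \<Rightarrow> nat \<Rightarrow> nat"
    and E :: "(nat \<Rightarrow> nat) set \<Rightarrow> ((nat \<Rightarrow> nat) \<Rightarrow> complex) \<Rightarrow> (nat \<Rightarrow> nat) \<Rightarrow> complex"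
    and f :: "(nat \<Rightarrow> nat) \<Rightarrow> complex"
  assumes pvm: "projection_valued_measure (mu N A) E"
    and E_cylinder: "\<forall>k. \<forall>a\<in>words N A k. \<forall>h\<in>L2 (mu N A).
           AE x in mu N A. E (cylinder N A a) h x = S_word N A a (S_word_adj N A a h) x"
    and f: "f \<in> L2 (mu N A)"
begin

abbreviation "\<nu> \<equiv> spectral_measure (mu N A) E f"

lemma emeasure_cylinder:
  assumes a: "a \<in> words N A k"
  shows "emeasure \<nu> (cylinder N A a) = ennreal ((L2_norm (mu N A) (S_word_adj N A a f))\<^sup>2)"
proof -
  have adj: "adjointable (mu N A) (S_word N A a)"
    by (rule adjointable_S_word[OF words_letters[OF a]])
  have "S_word_adj N A a f \<in> L2 (mu N A)"
    unfolding S_word_adj_def by (rule L2_adjoint_adjointable(1)[OF adj f])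
  then have SS: "S_word N A a (S_word_adj N A a f) \<in> L2 (mu N A)"
    using adj by (simp add: adjointable_def)
  have "AE x in mu N A. E (cylinder N A a) f x = S_word N A a (S_word_adj N A a f) x"
    using E_cylinder a f by simp
  then have "L2_inner (mu N A) f (E (cylinder N A a) f)
      = L2_inner (mu N A) f (S_word N A a (S_word_adj N A a f))"
    by (rule L2_inner_cong_AE[OF _ pvm_L2[OF pvm f cylinder_sets] SS f])
  then show ?thesis
    by (simp add: emeasure_spectral_measure[OF pvm f cylinder_sets] inner_S_word_S_word_adj[OF a f])
qed

lemma Nadic_trunc_measurable_spectral: "Nadic_trunc N k \<in> borel_measurable \<nu>"
  and Nadic_measurable_spectral: "Nadic N \<in> borel_measurable \<nu>"
  by (simp_all only: measurable_cong_sets[OF sets_spectral_measure[OF pvm f] refl]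
      Nadic_trunc_measurable Nadic_measurable)

text \<open>
  The measure \<open>\<mu>\<^sub>f\<^sup>(\<^sup>k\<^sup>)\<close> is the image of the spectral measure under truncation to \<open>k\<close> digits,
  since the cylinders of the admissible words of length \<open>k\<close> partition \<open>\<Lambda>\<^sub>A\<close>.
\<close>

lemma mu_f_approx_eq_distr: "mu_f_approx N A f k = distr \<nu> borel (Nadic_trunc N k)"
proof -
  have eq: "(\<Sum>a\<in>words N A k. ennreal ((L2_norm (mu N A) (S_word_adj N A a f))\<^sup>2) *
              emeasure (return borel (word_point N a)) B)
      = emeasure \<nu> (Nadic_trunc N k -` B \<inter> space \<nu>)"
    if B: "B \<in> sets borel" for B
  proof -
    let ?C = "\<lambda>a. cylinder N A a \<inter> (if word_point N a \<in> B then UNIV else {})"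
    have union: "Nadic_trunc N k -` B \<inter> space \<nu> = (\<Union>a\<in>words N A k. ?C a)"
    proof (intro set_eqI iffI)
      fix x assume x: "x \<in> Nadic_trunc N k -` B \<inter> space \<nu>"
      then have "x \<in> Lambda N A" by (simp add: space_spectral_measure[OF pvm f] space_mu)
      note p = prefix_in_words[OF this, of k]
      then have "word_point N (map x [0..<k]) \<in> B"
        using x Nadic_trunc_cylinder[OF p(2)] by simp
      then show "x \<in> (\<Union>a\<in>words N A k. ?C a)"
        using p by auto
    next
      fix x assume "x \<in> (\<Union>a\<in>words N A k. ?C a)"
      then obtain a where a: "a \<in> words N A k" "x \<in> cylinder N A a" "word_point N a \<in> B"
        by (auto split: if_splits)
      then have "length a = k" by (simp add: words_def)
      then show "x \<in> Nadic_trunc N k -` B \<inter> space \<nu>"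
        using a Nadic_trunc_cylinder[OF a(2)]
        by (simp add: space_spectral_measure[OF pvm f] space_mu cylinder_def)
    qed
    have disj: "disjoint_family_on ?C (words N A k)"
      unfolding disjoint_family_on_def
    proof (intro ballI impI)
      fix a b assume ab: "a \<in> words N A k" "b \<in> words N A k" "a \<noteq> b"
      then have "length a = length b" by (simp add: words_def)
      then show "?C a \<inter> ?C b = {}"
        using ab cylinder_prefix[of _ N A a] cylinder_prefix[of _ N A b] by fastforce
    qed
    have sets: "?C ` words N A k \<subseteq> sets \<nu>"
      using cylinder_sets by (auto simp: sets_spectral_measure[OF pvm f])
    have "emeasure \<nu> (Nadic_trunc N k -` B \<inter> space \<nu>) = (\<Sum>a\<in>words N A k. emeasure \<nu> (?C a))"
      unfolding union by (rule sum_emeasure[OF sets disj finite_words, symmetric])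
    also have "\<dots> = (\<Sum>a\<in>words N A k. ennreal ((L2_norm (mu N A) (S_word_adj N A a f))\<^sup>2) *
              emeasure (return borel (word_point N a)) B)"
      using B by (intro sum.cong refl) (simp add: emeasure_cylinder)
    finally show ?thesis by simp
  qed
  show ?thesis
    unfolding mu_f_approx_def distr_def space_borel
    using sets.sigma_sets_eq[of "borel :: real measure"]
    by (intro measure_of_eq eq) simp_all
qed

lemma integral_mu_f_approx_tendsto:
  fixes g :: "real \<Rightarrow> complex"
  assumes cont: "continuous_on UNIV g" and bound: "\<And>x. cmod (g x) \<le> B"
  shows "(\<lambda>k. \<integral>x. g x \<partial>mu_f_approx N A f k) \<longlonglongrightarrow> (\<integral>x. g x \<partial>mu_f N A E f)"
proof -
  interpret finite_measure \<nu>
    by (rule finite_measure_spectral_measure[OF pvm f])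
  note [measurable] = Nadic_trunc_measurable_spectral Nadic_measurable_spectral
  have [measurable]: "g \<in> borel_measurable borel"
    by (rule borel_measurable_continuous_onI[OF cont])
  have "(\<lambda>k. \<integral>x. g (Nadic_trunc N k x) \<partial>\<nu>) \<longlonglongrightarrow> (\<integral>x. g (Nadic N x) \<partial>\<nu>)"
  proof (rule integral_dominated_convergence[where w="\<lambda>_. B"])
    show "AE x in \<nu>. (\<lambda>k. g (Nadic_trunc N k x)) \<longlonglongrightarrow> g (Nadic N x)"
    proof (rule AE_I2)
      fix x assume "x \<in> space \<nu>"
      then have "x \<in> Lambda N A" by (simp add: space_spectral_measure[OF pvm f] space_mu)
      then show "(\<lambda>k. g (Nadic_trunc N k x)) \<longlonglongrightarrow> g (Nadic N x)"
        using cont by (intro isCont_tendsto_compose[OF _ Nadic_trunc_tendsto])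
          (auto simp: continuous_on_eq_continuous_at)
    qed
  qed (use bound in auto)
  then show ?thesis
    unfolding mu_f_approx_eq_distr mu_f_def by (simp add: integral_distr)
qed

end

theorem corollary2p22:
  fixes N :: nat
    and A :: "nat \<Rightarrow> nat \<Rightarrow> nat"
    and E :: "(nat \<Rightarrow> nat) set \<Rightarrow> ((nat \<Rightarrow> nat) \<Rightarrow> complex) \<Rightarrow> (nat \<Rightarrow> nat) \<Rightarrow> complex"
    and f :: "(nat \<Rightarrow> nat) \<Rightarrow> complex"
  assumes "\<forall>i<N. \<forall>j<N. A i j \<in> {0, 1}"
    and "\<forall>i<N. A i i = 1"
    and "projection_valued_measure (mu N A) E"
    and "\<forall>k. \<forall>a\<in>words N A k. \<forall>h\<in>L2 (mu N A).
           AE x in mu N A. E (cylinder N A a) h x = S_word N A a (S_word_adj N A a h) x"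
    and "f \<in> L2 (mu N A)"
    and "L2_norm (mu N A) f = 1"
  shows "\<forall>\<psi>\<in>test_space. \<exists>g. continuous_representative \<psi> g \<and>
           (\<lambda>k. \<integral>x. g x \<partial>mu_f_approx N A f k) \<longlonglongrightarrow> (\<integral>x. g x \<partial>mu_f N A E f)"
proof
  fix \<psi> assume "\<psi> \<in> test_space"
  then obtain g B where g: "continuous_representative \<psi> g" and bound: "\<And>x. cmod (g x) \<le> B"
    by (rule test_space_bounded_continuous_representative) blast
  have "(\<lambda>k. \<integral>x. g x \<partial>mu_f_approx N A f k) \<longlonglongrightarrow> (\<integral>x. g x \<partial>mu_f N A E f)"
    using g bound by (intro integral_mu_f_approx_tendsto[OF assms(3-5)])
      (auto simp: continuous_representative_def)
  with g show "\<exists>g. continuous_representative \<psi> g \<and>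
      (\<lambda>k. \<integral>x. g x \<partial>mu_f_approx N A f k) \<longlonglongrightarrow> (\<integral>x. g x \<partial>mu_f N A E f)"
    by blast
qed

end
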